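(* Let $n\ge 3$ and let $X_1,\ldots,X_n$ be independent random variables uniformly distributed on $[0,1]$, and $Q=\sum_{i=1}^n(X_i-\overline X)^2$. Let $Q_{\max}=n/4$ if $n$ is even and $Q_{\max}=(n^2-1)/(4n)$ if $n$ is odd, and let $t_k=\pi k/Q_{\max}$ for $k\ge1$ (i.e. $t_k=4k\pi/n$ for even $n$ and $t_k=4k\pi n/(n^2-1)$ for odd $n$). Then for $0\le x<Q_{\max}$, \[ \begin{aligned} \Pr\{Q\le x\}=\tfrac12\sqrt n\,(\sqrt\pi/2)^{n-3}\Bigg(&\int_0^\infty\sum_{k=1}^\infty \mathrm{Im}\Big((i/t_k)^{n/2}\big(\mathrm{erf}(y+\sqrt{-it_k})-\mathrm{erf}(y)\big)^n\Big)\frac{1-\cos(t_kx)}{k}\,dy\\ &+\frac12\int_0^1\sum_{k=1}^\infty \mathrm{Im}\Big((i/t_k)^{(n-1)/2}\big(\mathrm{erf}(\tfrac12\sqrt{-it_k}(u+1))-\mathrm{erf}(\tfrac12\sqrt{-it_k}(u-1))\big)^n\Big)\frac{1-\cos(t_kx)}{k}\,du\Bigg). \end{aligned} \]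
   Context: $\mathrm{erf}(z)=\frac{2}{\sqrt\pi}\int_0^z e^{-w^2}\,dw$ is the entire error function. Powers and roots use principal branches: for $t>0$, $\sqrt{-it}=\sqrt t\,e^{-i\pi/4}$ and $(i/t)^s=t^{-s}e^{i\pi s/2}$ for real $s$. $\mathrm{Im}$ denotes the imaginary part. *)

theory Defs
  imports "HOL-Probability.Probability"
begin

text \<open>Entire error function:
  erf z = 2/sqrt pi * integral over the segment [0,z] of exp(-w^2) dw,
  written with the parametrisation w = s z, s in [0,1].\<close>
definition cerf :: "complex \<Rightarrow> complex" where
  "cerf z = (2 / complex_of_real (sqrt pi)) * z * integral {0..1} (\<lambda>s::real. exp (- ((complex_of_real s * z)\<^sup>2)))"

definition Qmax :: "nat \<Rightarrow> real" where
  "Qmax n = (if even n then real n / 4 else (real n ^ 2 - 1) / (4 * real n))"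

definition tk :: "nat \<Rightarrow> nat \<Rightarrow> real" where
  "tk n k = pi * real k / Qmax n"

definition sumsq_dev :: "nat \<Rightarrow> (nat \<Rightarrow> real) \<Rightarrow> real" where
  "sumsq_dev n X = (\<Sum>i<n. (X i - (\<Sum>j<n. X j) / real n)\<^sup>2)"

end

theory Submission
  imports Defs "HOL-Complex_Analysis.Complex_Analysis"
begin

text \<open>Put \<open>a = \<pi> Q / Qmax\<close> and \<open>b = \<pi> x / Qmax\<close>.  Abel-summing the sawtooth series
  \<open>\<Sum> sin (k \<theta>) / k\<close>, the imaginary part of \<open>- Ln (1 - r cis \<theta>)\<close>, gives almost surely
  \<open>(2 / \<pi>) \<Sum> sin (k a) (1 - cos (k b)) / k = 1\<close> for \<open>Q < x\<close> and \<open>0\<close> for \<open>Q > x\<close>, so only the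
  characteristic function of \<open>Q\<close> at the points \<open>t\<^sub>k\<close> is needed.

  For real \<open>s > 0\<close>, integrating \<open>exp (- s\<^sup>2 \<Sum> (X\<^sub>i - m)\<^sup>2)\<close> over \<open>m \<in> \<real>\<close> linearises the square of the mean
  and turns \<open>E exp (- s\<^sup>2 Q)\<close> into the integral of the \<open>n\<close>-th power of a difference of error functions.  The
  range \<open>0 \<le> m \<le> 1\<close> yields the integral over \<open>u\<close>, the two outer ranges yield the integral over \<open>y\<close>.  After
  multiplication by \<open>s\<^sup>n\<close> both sides are entire in \<open>s\<close>, so the identity also holds at
  \<open>s = csqrt (- \<i> t\<^sub>k)\<close>; no contour has to be rotated.  Finally, the integrands are bounded by
  \<open>C exp (- y\<^sup>2)\<close> on the ray through \<open>csqrt (- \<i>)\<close>, uniformly in \<open>k\<close>, which justifies exchanging sum and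
  integral.\<close>

section \<open>The entire error function\<close>

text \<open>The integrand is entire, so it has a primitive \<open>G\<close> on the whole plane. The
  definition of \<open>cerf\<close> is its segment integral from 0, hence \<open>cerf\<close> is a
  multiple of \<open>G\<close> minus a constant, and the fundamental theorem of calculus gives both
  claims.\<close>

lemma cerf_diff_integral:
  "cerf b - cerf a = 2 / complex_of_real (sqrt pi) * (b - a) *
     integral {0..1} (\<lambda>r::real. exp (- ((a + complex_of_real r * (b - a))\<^sup>2)))"
  and cerf_has_field_derivative:
  "(cerf has_field_derivative 2 / complex_of_real (sqrt pi) * exp (- z\<^sup>2)) (at z)"
proof -
  have "(\<lambda>z::complex. exp (- z\<^sup>2)) holomorphic_on UNIV"
    by (intro holomorphic_intros)
  then obtain G where G: "\<And>z::complex. (G has_field_derivative exp (- z\<^sup>2)) (at z)"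
    using holomorphic_convex_primitive'[of UNIV "\<lambda>z::complex. exp (- z\<^sup>2)"] by auto
  have seg: "(b - a) * integral {0..1} (\<lambda>r::real. exp (- ((a + complex_of_real r * (b - a))\<^sup>2))) = G b - G a"
    for a b
  proof -
    have "((\<lambda>r::real. (b - a) * exp (- ((a + complex_of_real r * (b - a))\<^sup>2))) has_integral
            G (a + complex_of_real 1 * (b - a)) - G (a + complex_of_real 0 * (b - a))) {0..1}"
    proof (rule fundamental_theorem_of_calculus)
      fix r :: real
      have "((\<lambda>r. a + complex_of_real r * (b - a)) has_vector_derivative (b - a)) (at r within {0..1})"
        by (auto intro!: derivative_eq_intros simp: has_vector_derivative_def scaleR_conv_of_real)
      from field_vector_diff_chain_within[OF this, of G, OF has_field_derivative_at_within[OF G]]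
      show "((\<lambda>r. G (a + complex_of_real r * (b - a))) has_vector_derivative
              (b - a) * exp (- ((a + complex_of_real r * (b - a))\<^sup>2))) (at r within {0..1})"
        by (simp add: o_def)
    qed simp
    from integral_unique[OF this] show ?thesis by simp
  qed
  have cerf_G: "cerf z = 2 / complex_of_real (sqrt pi) * (G z - G 0)" for z
    using seg[of z 0] by (simp add: cerf_def mult.assoc)
  show "cerf b - cerf a = 2 / complex_of_real (sqrt pi) * (b - a) *
     integral {0..1} (\<lambda>r::real. exp (- ((a + complex_of_real r * (b - a))\<^sup>2)))"
    unfolding mult.assoc seg cerf_G by (simp add: right_diff_distrib)
  have "((\<lambda>z. 2 / complex_of_real (sqrt pi) * (G z - G 0)) has_field_derivative
          2 / complex_of_real (sqrt pi) * exp (- z\<^sup>2)) (at z)"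
    by (rule DERIV_cong[OF DERIV_cmult[OF DERIV_diff[OF G DERIV_const]]]) simp
  then show "(cerf has_field_derivative 2 / complex_of_real (sqrt pi) * exp (- z\<^sup>2)) (at z)"
    by (simp add: cerf_G[abs_def])
qed

lemma cerf_minus: "cerf (- z) = - cerf z"
  by (simp add: cerf_def)

lemma cerf_holomorphic: "cerf holomorphic_on S"
  using cerf_has_field_derivative
  by (meson DERIV_subset has_field_derivative_at_within field_differentiable_def holomorphic_on_def)

lemma holomorphic_on_cerf [holomorphic_intros]:
  "f holomorphic_on S \<Longrightarrow> (\<lambda>z. cerf (f z)) holomorphic_on S"
  using holomorphic_on_compose[OF _ cerf_holomorphic, of f S] by (simp add: o_def)

lemma continuous_on_cerf [continuous_intros]:
  "continuous_on S f \<Longrightarrow> continuous_on S (\<lambda>z. cerf (f z))"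
  by (rule continuous_on_compose2[OF holomorphic_on_imp_continuous_on[OF cerf_holomorphic[of UNIV]]]) auto

lemma cerf_measurable [measurable]: "cerf \<in> borel_measurable borel"
  by (intro borel_measurable_continuous_onI continuous_intros)

text \<open>Mean value inequality on the disc of radius \<open>norm s\<close> about
  \<open>y\<close>, with the derivative replaced by a bound valid on that disc. The estimate is
  wasteful in \<open>s\<close> but keeps Gaussian decay in \<open>y\<close> locally uniformly in
  \<open>s\<close>, which serves the holomorphy of the outer integral.\<close>

lemma norm_cerf_shift_le:
  "norm (cerf (complex_of_real y + s) - cerf (complex_of_real y))
    \<le> 2 / sqrt pi * norm s * exp (- y\<^sup>2 + 2 * \<bar>y\<bar> * norm s + (norm s)\<^sup>2)"
proof -
  have "norm (cerf (complex_of_real y + s) - cerf (complex_of_real y))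
    \<le> (2 / sqrt pi * exp (- y\<^sup>2 + 2 * \<bar>y\<bar> * norm s + (norm s)\<^sup>2)) * norm (complex_of_real y + s - complex_of_real y)"
  proof (rule field_differentiable_bound[of "cball (complex_of_real y) (norm s)"])
    fix z assume z: "z \<in> cball (complex_of_real y) (norm s)"
    define w where "w = z - complex_of_real y"
    have w: "norm w \<le> norm s" using z by (simp add: w_def dist_norm norm_minus_commute)
    have "z\<^sup>2 = complex_of_real (y\<^sup>2) + complex_of_real (2 * y) * w + w\<^sup>2"
      by (simp add: w_def power2_eq_square algebra_simps)
    then have "Re (z\<^sup>2) = y\<^sup>2 + 2 * y * Re w + Re (w\<^sup>2)"
      by simp
    moreover have "\<bar>2 * y * Re w\<bar> \<le> 2 * \<bar>y\<bar> * norm s"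
      using abs_Re_le_cmod[of w] w by (simp add: abs_mult mult_left_mono)
    moreover have "\<bar>Re (w\<^sup>2)\<bar> \<le> (norm s)\<^sup>2"
      using order_trans[OF abs_Re_le_cmod[of "w\<^sup>2"], of "(norm s)\<^sup>2"] power_mono[OF w norm_ge_zero, of 2]
      by (simp add: norm_power)
    ultimately have "- Re (z\<^sup>2) \<le> - y\<^sup>2 + 2 * \<bar>y\<bar> * norm s + (norm s)\<^sup>2"
      by linarith
    then show "norm (2 / complex_of_real (sqrt pi) * exp (- z\<^sup>2))
        \<le> 2 / sqrt pi * exp (- y\<^sup>2 + 2 * \<bar>y\<bar> * norm s + (norm s)\<^sup>2)"
      by (simp add: norm_mult norm_divide divide_right_mono)
    show "(cerf has_field_derivative 2 / complex_of_real (sqrt pi) * exp (- z\<^sup>2))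
        (at z within cball (complex_of_real y) (norm s))"
      by (rule has_field_derivative_at_within[OF cerf_has_field_derivative])
  qed (auto simp: dist_norm)
  then show ?thesis by (simp add: mult_ac)
qed

text \<open>Along this direction the modulus of \<open>exp (- u^2)\<close> never exceeds
  \<open>exp (- y^2)\<close>. A stretch of length at most 1 is estimated directly, the rest by one
  integration by parts. The bound is free of \<open>b\<close>, hence uniform over all
  \<open>t\<^sub>k\<close>.\<close>

lemma norm_cerf_ray_le:
  fixes y b :: real
  assumes "y \<ge> 0" "b \<ge> 0"
  shows "norm (cerf (complex_of_real y + complex_of_real b * ((1 - \<i>) / complex_of_real (sqrt 2))) - cerf (complex_of_real y))
    \<le> 4 / sqrt pi * exp (- y\<^sup>2)"
proof -
  define \<omega> where "\<omega> = (1 - \<i>) / complex_of_real (sqrt 2)"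
  define z where "z = (\<lambda>r. complex_of_real y + complex_of_real r * \<omega>)"
  define E where "E = exp (- y\<^sup>2)"
  have E0: "E > 0" by (simp add: E_def)
  have Rew: "Re \<omega> = 1 / sqrt 2" "Im \<omega> = - 1 / sqrt 2"
    by (simp_all add: \<omega>_def Re_divide Im_divide power2_eq_square real_div_sqrt)
  have nw: "norm \<omega> = 1"
    by (simp add: cmod_def Rew power_divide)
  have Rez: "Re (z r) = y + r / sqrt 2" "Im (z r) = - r / sqrt 2" for r
    by (simp_all add: z_def Rew)
  \<comment> \<open>Since \<omega>^2 = - \<i>, the term in r^2 is purely imaginary and drops out of
    the real part.\<close>
  have Rez2: "Re ((z r)\<^sup>2) = y\<^sup>2 + 2 * y * r / sqrt 2" for r
    by (simp add: power2_eq_square Rez algebra_simps)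
  have ne: "norm (exp (- (z r)\<^sup>2)) \<le> E" if "r \<ge> 0" for r
    using that assms by (simp add: Rez2 E_def)
  have nz: "norm (z r) \<ge> r" if "r \<ge> 0" for r
  proof -
    have "(norm (z r))\<^sup>2 = y\<^sup>2 + 2 * y * r / sqrt 2 + r\<^sup>2"
      by (simp add: cmod_power2 Rez) (simp add: power2_eq_square algebra_simps)
    then have "r\<^sup>2 \<le> (norm (z r))\<^sup>2" using that assms by simp
    then show ?thesis using power2_le_imp_le norm_ge_zero by blast
  qed
  have zd: "(z has_vector_derivative \<omega>) (at r)" for r
    unfolding z_def by (auto intro!: derivative_eq_intros simp: has_vector_derivative_def scaleR_conv_of_real)
  define C where "C = (\<lambda>u. complex_of_real (sqrt pi / 2) * cerf u)"
  have Cd: "(C has_field_derivative exp (- u\<^sup>2)) (at u)" for u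
    unfolding C_def
    by (rule DERIV_cong[OF DERIV_cmult[OF cerf_has_field_derivative]]) (simp add: field_simps)
  have Czd: "((\<lambda>r. C (z r)) has_vector_derivative \<omega> * exp (- (z r)\<^sup>2)) (at r)" for r
    using field_vector_diff_chain_within[OF zd has_field_derivative_at_within[OF Cd]] by (simp add: o_def)
  have first: "norm (C (z c) - C (z 0)) \<le> E" if "0 \<le> c" "c \<le> 1" for c
  proof (cases "c = 0")
    case False
    have "norm (C (z c) - C (z 0)) \<le> E * c - E * 0"
    proof (rule differentiable_bound_general[where f = "\<lambda>r. C (z r)"])
      show "continuous_on {0..c} (\<lambda>r. C (z r))"
        using Czd has_vector_derivative_continuous continuous_at_imp_continuous_on by blast
      show "((*) E has_vector_derivative E) (at r)" for r
        by (auto intro!: derivative_eq_intros simp: has_vector_derivative_def)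
      show "norm (\<omega> * exp (- (z r)\<^sup>2)) \<le> E" if "0 < r" for r
        using ne[of r] that by (simp add: norm_mult nw)
    qed (use False that Czd in \<open>auto intro!: continuous_intros\<close>)
    also have "\<dots> \<le> E" using that E0 by simp
    finally show ?thesis .
  qed (use E0 in auto)
  \<comment> \<open>On this ray \<open>exp (- u\<^sup>2)\<close> only oscillates; subtracting the leading asymptotic term \<open>F\<close> leaves a
    function whose derivative is absolutely integrable away from the origin.\<close>
  define F where "F = (\<lambda>u::complex. - exp (- u\<^sup>2) / (2 * u))"
  have nF: "norm (F (z r)) \<le> E / (2 * r)" if "r \<ge> 1" for r
    using ne[of r] nz[of r] that E0 by (simp add: F_def norm_divide norm_mult frac_le)
  have second: "norm (C (z b) - C (z 1)) \<le> E" if b1: "b > 1"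
  proof -
    have Fd: "((\<lambda>u. C u - F u) has_field_derivative - exp (- u\<^sup>2) / (2 * u\<^sup>2)) (at u)" if "u \<noteq> 0" for u
    proof -
      have "(F has_field_derivative exp (- u\<^sup>2) + exp (- u\<^sup>2) / (2 * u\<^sup>2)) (at u)"
        unfolding F_def
        using that
        by (auto intro!: derivative_eq_intros) (simp add: field_simps power2_eq_square)
      from DERIV_diff[OF Cd this] show ?thesis by simp
    qed
    have Fzd: "((\<lambda>r. C (z r) - F (z r)) has_vector_derivative \<omega> * (- exp (- (z r)\<^sup>2) / (2 * (z r)\<^sup>2))) (at r)"
      if "r > 0" for r
    proof -
      have "z r \<noteq> 0" using nz[of r] that by auto
      then show ?thesis
        using field_vector_diff_chain_within[OF zd has_field_derivative_at_within[OF Fd]] by (simp add: o_def)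
    qed
    \<comment> \<open>The derivative is at most \<open>E / (2 * r^2)\<close>, with primitive
      \<open>- (E / 2) / r\<close>. The variation \<open>E / 2 - E / (2 * b)\<close> and the
      boundary terms \<open>E / (2 * b)\<close> and \<open>E / 2\<close> add up to exactly
      \<open>E\<close>.\<close>
    have "norm ((C (z b) - F (z b)) - (C (z 1) - F (z 1))) \<le> (- (E / 2) / b) - (- (E / 2) / 1)"
    proof (rule differentiable_bound_general[where f = "\<lambda>r. C (z r) - F (z r)" and \<phi> = "\<lambda>r. - (E / 2) / r"])
      show "continuous_on {1..b} (\<lambda>r. C (z r) - F (z r))"
        by (intro continuous_at_imp_continuous_on ballI has_vector_derivative_continuous[OF Fzd]) auto
      show "((\<lambda>r. - (E / 2) / r) has_vector_derivative E / (2 * r\<^sup>2)) (at r)" if "1 < r" for r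
        using that by (auto intro!: derivative_eq_intros simp: has_real_derivative_iff_has_vector_derivative[symmetric] power2_eq_square)
      show "norm (\<omega> * (- exp (- (z r)\<^sup>2) / (2 * (z r)\<^sup>2))) \<le> E / (2 * r\<^sup>2)" if "1 < r" for r
        using ne[of r] nz[of r] that E0 by (simp add: norm_divide norm_mult nw norm_power frac_le power_mono)
    qed (use b1 Fzd in \<open>auto intro!: continuous_intros\<close>)
    moreover have "norm (F (z b)) \<le> E / (2 * b)" "norm (F (z 1)) \<le> E / (2 * 1)"
      using nF b1 by (simp_all del: mult_1_right)
    moreover have "C (z b) - C (z 1) = ((C (z b) - F (z b)) - (C (z 1) - F (z 1))) + F (z b) - F (z 1)"
      by simp
    ultimately show ?thesis
      using norm_triangle_ineq4[of "((C (z b) - F (z b)) - (C (z 1) - F (z 1))) + F (z b)" "F (z 1)"]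
        norm_triangle_ineq[of "((C (z b) - F (z b)) - (C (z 1) - F (z 1)))" "F (z b)"]
      by (simp add: field_simps)
  qed
  \<comment> \<open>One \<open>E\<close> for each of the two stretches; the factor
    \<open>2 / sqrt pi\<close> between \<open>C\<close> and \<open>cerf\<close> then produces
    \<open>4 / sqrt pi\<close>.\<close>
  have "norm (C (z b) - C (z 0)) \<le> 2 * E"
  proof (cases "b > 1")
    case True
    then show ?thesis
      using first[of 1] second norm_triangle_ineq[of "C (z b) - C (z 1)" "C (z 1) - C (z 0)"] by simp
  next
    case False
    then show ?thesis using first[of b] assms E0 by simp
  qed
  moreover have "C (z b) - C (z 0) = complex_of_real (sqrt pi / 2) * (cerf (z b) - cerf (z 0))"
    by (simp add: C_def right_diff_distrib)
  then have "norm (C (z b) - C (z 0)) = sqrt pi / 2 * norm (cerf (z b) - cerf (z 0))"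
    by (simp only: norm_mult) simp
  ultimately have "norm (cerf (z b) - cerf (z 0)) \<le> 4 / sqrt pi * E"
    by (simp add: field_simps)
  then show ?thesis by (simp add: z_def \<omega>_def E_def)
qed

section \<open>Holomorphy of integrals depending on a complex parameter\<close>

text \<open>Cauchy's estimate on unit circles turns a majorant of the integrand into one of its
  derivative, hence of the difference quotients; dominated convergence then permits differentiation
  under the integral sign.\<close>

lemma holomorphic_integral_dominated:
  fixes f :: "complex \<Rightarrow> 'a \<Rightarrow> complex"
  assumes meas: "\<And>s. f s \<in> borel_measurable M"
    and hol: "\<And>x. x \<in> space M \<Longrightarrow> (\<lambda>s. f s x) holomorphic_on UNIV"
    and dom: "\<And>R. R > 0 \<Longrightarrow> \<exists>g. integrable M g \<and> (\<forall>s x. norm s \<le> R \<longrightarrow> x \<in> space M \<longrightarrow> norm (f s x) \<le> g x)"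
  shows "(\<lambda>s. \<integral>x. f s x \<partial>M) holomorphic_on UNIV"
proof -
  have "(\<lambda>s. \<integral>x. f s x \<partial>M) field_differentiable at z" for z
  proof -
    \<comment> \<open>Unit circles centred in \<open>cball z 1\<close> consist of points of modulus
      at most \<open>norm z + 2\<close>.\<close>
    define R where "R = norm z + 2"
    have "R > 0" by (simp add: R_def add_nonneg_pos)
    then obtain g where g: "integrable M g" and gb: "\<And>s x. norm s \<le> R \<Longrightarrow> x \<in> space M \<Longrightarrow> norm (f s x) \<le> g x"
      using dom by blast
    have int: "integrable M (f s)" if "norm s \<le> R" for s
      by (rule Bochner_Integration.integrable_bound[OF g meas])
         (use gb[OF that] in \<open>auto intro!: AE_I2 order_trans[OF _ abs_ge_self]\<close>)
    define d where "d = (\<lambda>x. deriv (\<lambda>s. f s x) z)"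
    have der: "((\<lambda>s. f s x) has_field_derivative deriv (\<lambda>s. f s x) w) (at w)" if "x \<in> space M" for x w
      using hol[OF that] by (meson UNIV_I holomorphic_derivI open_UNIV)
    have derb: "norm (deriv (\<lambda>s. f s x) w) \<le> g x" if "x \<in> space M" "w \<in> cball z 1" for x w
    proof -
      have "norm ((deriv ^^ 1) (\<lambda>s. f s x) w) \<le> fact 1 * g x / 1 ^ 1"
      proof (rule Cauchy_inequality)
        show "(\<lambda>s. f s x) holomorphic_on ball w 1" "continuous_on (cball w 1) (\<lambda>s. f s x)"
          using hol[OF that(1)] holomorphic_on_subset holomorphic_on_imp_continuous_on by blast+
        fix v assume "cmod (w - v) = 1"
        then have "norm v \<le> R"
          using that(2) norm_triangle_ineq[of "v - w" "w - z"] norm_triangle_ineq[of "v - z" z]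
          by (simp add: R_def dist_norm norm_minus_commute)
        then show "norm (f v x) \<le> g x" using gb that(1) by blast
      qed simp
      then show ?thesis by simp
    qed
    have "((\<lambda>h. ((\<integral>x. f (z + h) x \<partial>M) - (\<integral>x. f z x \<partial>M)) / h) \<longlongrightarrow> (\<integral>x. d x \<partial>M)) (at 0)"
      unfolding tendsto_at_iff_sequentially
    proof (intro allI impI)
      fix X :: "nat \<Rightarrow> complex" assume X0: "\<forall>i. X i \<in> UNIV - {0}" and X: "X \<longlonglongrightarrow> 0"
      have "eventually (\<lambda>i. norm (X i) < 1) sequentially"
        using tendstoD[OF X, of 1] by (simp add: dist_norm)
      \<comment> \<open>Dropping the first \<open>N\<close> terms keeps \<open>z + X i\<close>
        inside \<open>cball z 1\<close>, where \<open>derb\<close> applies;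
        \<open>LIMSEQ_offset\<close> restores them at the end.\<close>
      then obtain N where N: "\<And>i. i \<ge> N \<Longrightarrow> norm (X i) < 1"
        by (auto simp: eventually_sequentially)
      define q where "q = (\<lambda>i x. (f (z + X (i + N)) x - f z x) / X (i + N))"
      have X0': "X i \<noteq> 0" for i using X0 by auto
      have qm: "q i \<in> borel_measurable M" for i
        unfolding q_def using meas by measurable
      have qlim: "(\<lambda>i. q i x) \<longlonglongrightarrow> d x" if "x \<in> space M" for x
      proof -
        have "((\<lambda>h. (f (z + h) x - f z x) / h) \<longlongrightarrow> d x) (at 0)"
          using der[OF that, of z] by (simp add: d_def DERIV_def)
        then have "((\<lambda>h. (f (z + h) x - f z x) / h) \<circ> X) \<longlonglongrightarrow> d x"
          using X0 X unfolding tendsto_at_iff_sequentially by blast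
        from LIMSEQ_ignore_initial_segment[OF this, of N] show ?thesis
          by (simp add: o_def q_def)
      qed
      have dm: "d \<in> borel_measurable M"
        using borel_measurable_LIMSEQ_metric[OF qm qlim] .
      have "(\<lambda>i. \<integral>x. q i x \<partial>M) \<longlonglongrightarrow> (\<integral>x. d x \<partial>M)"
      proof (rule integral_dominated_convergence[OF dm qm g])
        show "AE x in M. (\<lambda>i. q i x) \<longlonglongrightarrow> d x" using qlim by auto
        fix i
        have "norm (q i x) \<le> g x" if x: "x \<in> space M" for x
        proof -
          have "norm (f (z + X (i + N)) x - f z x) \<le> g x * norm (z + X (i + N) - z)"
            by (rule field_differentiable_bound[of "cball z 1"])
               (use derb[OF x] N[of "i + N"] der[OF x] in
                 \<open>auto intro: has_field_derivative_at_within simp: dist_norm norm_minus_commute\<close>)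
          then show ?thesis using X0'[of "i + N"] by (simp add: q_def norm_divide field_simps)
        qed
        then show "AE x in M. norm (q i x) \<le> g x" by auto
      qed
      moreover have "(\<integral>x. q i x \<partial>M) = ((\<integral>x. f (z + X (i + N)) x \<partial>M) - (\<integral>x. f z x \<partial>M)) / X (i + N)" for i
      proof -
        have "norm (z + X (i + N)) \<le> R" "norm z \<le> R"
          using N[of "i + N"] norm_triangle_ineq[of z "X (i + N)"] by (auto simp: R_def)
        then show ?thesis using int by (simp add: q_def)
      qed
      ultimately have "(\<lambda>i. ((\<lambda>h. ((\<integral>x. f (z + h) x \<partial>M) - (\<integral>x. f z x \<partial>M)) / h) \<circ> X) (i + N)) \<longlonglongrightarrow> (\<integral>x. d x \<partial>M)"
        by (simp add: o_def)
      then show "((\<lambda>h. ((\<integral>x. f (z + h) x \<partial>M) - (\<integral>x. f z x \<partial>M)) / h) \<circ> X) \<longlonglongrightarrow> (\<integral>x. d x \<partial>M)"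
        by (rule LIMSEQ_offset)
    qed
    then show ?thesis unfolding field_differentiable_def DERIV_def by blast
  qed
  then show ?thesis by (simp add: holomorphic_on_def)
qed

section \<open>The statistic on the unit cube\<close>

lemma sumsq_dev_alt:
  assumes "n > 0"
  shows "sumsq_dev n X = (\<Sum>i<n. (X i)\<^sup>2) - (\<Sum>i<n. X i)\<^sup>2 / real n"
proof -
  define c where "c = (\<Sum>j<n. X j) / real n"
  have "sumsq_dev n X = (\<Sum>i<n. (X i)\<^sup>2 - 2 * c * X i + c\<^sup>2)"
    by (simp add: sumsq_dev_def c_def power2_diff algebra_simps)
  also have "\<dots> = (\<Sum>i<n. (X i)\<^sup>2) - 2 * c * (\<Sum>i<n. X i) + real n * c\<^sup>2"
    by (simp add: sum.distrib sum_subtractf sum_distrib_left)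
  finally show ?thesis using assms by (simp add: c_def power2_eq_square field_simps)
qed

text \<open>Parallel-axis identity: \<open>m\<close> enters through a single square, so a Gaussian
  integral over \<open>m\<close> separates from the statistic. This is how the square of the mean
  gets linearised.\<close>

lemma sum_sq_shift_eq:
  assumes "n > 0"
  shows "(\<Sum>i<n. (X i - m)\<^sup>2) = sumsq_dev n X + real n * (m - (\<Sum>i<n. X i) / real n)\<^sup>2"
proof -
  have "(\<Sum>i<n. (X i - m)\<^sup>2) = (\<Sum>i<n. (X i)\<^sup>2 - 2 * m * X i + m\<^sup>2)"
    by (simp add: power2_diff algebra_simps)
  also have "\<dots> = (\<Sum>i<n. (X i)\<^sup>2) - 2 * m * (\<Sum>i<n. X i) + real n * m\<^sup>2"
    by (simp add: sum.distrib sum_subtractf sum_distrib_left)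
  finally have *: "(\<Sum>i<n. (X i - m)\<^sup>2) = (\<Sum>i<n. (X i)\<^sup>2) - 2 * m * (\<Sum>i<n. X i) + real n * m\<^sup>2" .
  show ?thesis
    unfolding sumsq_dev_alt[OF assms] * using assms by (simp add: power2_diff field_simps power2_eq_square)
qed

lemma sumsq_dev_nonneg: "sumsq_dev n X \<ge> 0"
  by (simp add: sumsq_dev_def sum_nonneg)

text \<open>The leading coefficient \<open>1 - 1 / n\<close> is what matters: being nonnegative it
  gives convexity in each coordinate, and being nonzero for \<open>n \<ge> 2\<close> it makes level
  sets in one coordinate finite.\<close>

lemma sumsq_dev_upd:
  fixes X :: "nat \<Rightarrow> real"
  assumes "i < n"
  defines "b \<equiv> (\<Sum>j\<in>{..<n} - {i}. X j)"
  shows "sumsq_dev n (X(i := y)) = (1 - 1 / real n) * y\<^sup>2 - (2 * b / real n) * y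
           + ((\<Sum>j\<in>{..<n} - {i}. (X j)\<^sup>2) - b\<^sup>2 / real n)"
proof -
  have n: "n > 0" using assms by simp
  have split: "(\<Sum>j<n. f j) = f i + (\<Sum>j\<in>{..<n} - {i}. f j)" for f :: "nat \<Rightarrow> real"
    using assms by (simp add: sum.remove)
  have "(\<Sum>j<n. ((X(i := y)) j)\<^sup>2) = y\<^sup>2 + (\<Sum>j\<in>{..<n} - {i}. (X j)\<^sup>2)"
    unfolding split by (auto intro!: sum.cong)
  moreover have "(\<Sum>j<n. (X(i := y)) j) = y + b"
    unfolding split b_def by simp
  ultimately show ?thesis
    unfolding sumsq_dev_alt[OF n] using n by (simp add: field_simps power2_eq_square)
qed

text \<open>As a function of a single coordinate the statistic is a convex parabola, so its maximum over
  the cube is attained at a vertex.\<close>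

lemma sumsq_dev_le_Qmax:
  assumes n: "n > 0" and X: "\<And>i. i < n \<Longrightarrow> 0 \<le> X i \<and> X i \<le> 1"
  shows "sumsq_dev n X \<le> Qmax n"
proof -
  \<comment> \<open>Induction on the set \<open>A\<close> of coordinates that may still lie strictly
    between 0 and 1; the empty set is the case of a vertex.\<close>
  have "sumsq_dev n X \<le> Qmax n"
    if "finite A" "A \<subseteq> {..<n}" "\<And>i. i < n \<Longrightarrow> 0 \<le> X i \<and> X i \<le> 1" "\<And>i. i < n \<Longrightarrow> i \<notin> A \<Longrightarrow> X i = 0 \<or> X i = 1" for A X
    using that
  proof (induction A arbitrary: X rule: finite_induct)
    case empty
    define B where "B = {i. i < n \<and> X i = 1}"
    define m where "m = card B"
    have fB: "finite B" "B \<subseteq> {..<n}" by (auto simp: B_def)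
    have ind: "X i = indicator B i" if "i < n" for i
      using empty(3)[OF that] that by (auto simp: B_def)
    have s: "(\<Sum>i<n. X i) = real m"
    proof -
      have "(\<Sum>i<n. X i) = (\<Sum>i<n. indicator B i)" by (rule sum.cong) (auto simp: ind)
      also have "\<dots> = real m"
        using fB by (simp add: m_def sum.inter_restrict[symmetric] indicator_def Int_absorb1 flip: sum.inter_filter)
      finally show ?thesis .
    qed
    moreover have "(\<Sum>i<n. (X i)\<^sup>2) = (\<Sum>i<n. X i)"
      by (rule sum.cong) (use empty(3) in force)+
    ultimately have Q: "sumsq_dev n X = real m - (real m)\<^sup>2 / real n"
      using n by (simp add: sumsq_dev_alt)
    \<comment> \<open>Completing the square leaves the defect \<open>(n - 2 * m)^2\<close>, which is
      at least 1 when \<open>n\<close> is odd; this parity is the source of the two cases of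
      \<open>Qmax\<close>.\<close>
    have "4 * (real n * real m - (real m)\<^sup>2) = (real n)\<^sup>2 - (real n - 2 * real m)\<^sup>2"
      by (simp add: power2_eq_square algebra_simps)
    moreover have "(real n - 2 * real m)\<^sup>2 \<ge> (if even n then 0 else 1)"
    proof (cases "even n")
      case False
      have "int n - 2 * int m \<noteq> 0" using False by presburger
      then have "(int n - 2 * int m)\<^sup>2 \<ge> 1"
        by (smt (verit) zero_less_power2)
      then have "real_of_int ((int n - 2 * int m)\<^sup>2) \<ge> 1" by linarith
      then show ?thesis using False by simp
    qed simp
    ultimately have "4 * (real n * real m - (real m)\<^sup>2) \<le> 4 * real n * Qmax n"
      using n by (auto simp: Qmax_def power2_eq_square split: if_splits)
    then show ?case using n by (simp add: Q field_simps)
  next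
    case (insert a A)
    have a: "a < n" using insert by auto
    have upd: "sumsq_dev n (X(a := v)) \<le> Qmax n" if "v = 0 \<or> v = 1" for v
      using that insert.prems by (intro insert.IH) auto
    define y where "y = X a"
    have y: "0 \<le> y" "y \<le> 1" using insert.prems(2)[OF a] by (auto simp: y_def)
    define \<alpha> \<beta> \<gamma> where "\<alpha> = 1 - 1 / real n" and "\<beta> = 2 * (\<Sum>j\<in>{..<n} - {a}. X j) / real n"
      and "\<gamma> = (\<Sum>j\<in>{..<n} - {a}. (X j)\<^sup>2) - (\<Sum>j\<in>{..<n} - {a}. X j)\<^sup>2 / real n"
    have f: "sumsq_dev n (X(a := v)) = \<alpha> * v\<^sup>2 - \<beta> * v + \<gamma>" for v
      unfolding sumsq_dev_upd[OF a] \<alpha>_def \<beta>_def \<gamma>_def ..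
    have "sumsq_dev n X = sumsq_dev n (X(a := y))" by (simp add: y_def)
    also have "\<dots> = \<alpha> * y\<^sup>2 - \<beta> * y + \<gamma>" by (rule f)
    \<comment> \<open>On the unit interval y^2 \<le> y replaces the convex parabola by its chord, an
      average of the two endpoint values.\<close>
    also have "\<dots> \<le> \<alpha> * y - \<beta> * y + \<gamma>"
    proof -
      have "\<alpha> \<ge> 0" using n by (simp add: \<alpha>_def)
      moreover have "y\<^sup>2 \<le> y" using y by (simp add: power2_eq_square mult_left_le)
      ultimately show ?thesis by (simp add: mult_left_mono)
    qed
    also have "\<dots> = (1 - y) * (\<alpha> * 0\<^sup>2 - \<beta> * 0 + \<gamma>) + y * (\<alpha> * 1\<^sup>2 - \<beta> * 1 + \<gamma>)"
      by (simp add: algebra_simps)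
    also have "\<dots> \<le> (1 - y) * Qmax n + y * Qmax n"
      using upd[of 0] upd[of 1] y unfolding f by (intro add_mono mult_left_mono) auto
    finally show ?case by (simp add: algebra_simps)
  qed
  from this[of "{..<n}" X] X show ?thesis by auto
qed

lemma Qmax_pos: "n \<ge> 2 \<Longrightarrow> Qmax n > 0"
  by (auto simp: Qmax_def power2_eq_square field_simps) (smt (verit) mult_less_cancel_left1 of_nat_less_iff of_nat_1 numeral_2_eq_2 Suc_le_eq One_nat_def)

section \<open>The uniform law on the cube and its null level sets\<close>

abbreviation unif :: "real measure" where "unif \<equiv> uniform_measure lborel {0..1}"
abbreviation cube :: "nat \<Rightarrow> (nat \<Rightarrow> real) measure" where "cube n \<equiv> \<Pi>\<^sub>M i\<in>{..<n}. unif"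

lemma prob_space_unif: "prob_space unif"
  by (rule prob_space_uniform_measure) auto

lemma product_prob_space_unif: "product_prob_space (\<lambda>i::nat. unif)"
  using prob_space_unif
  by (simp add: product_prob_space_def product_prob_space_axioms_def product_sigma_finite_def prob_space_imp_sigma_finite)

lemma prob_space_cube: "prob_space (cube n)"
  by (rule prob_space_PiM) (rule prob_space_unif)

lemma sumsq_dev_measurable [measurable]: "sumsq_dev n \<in> borel_measurable (cube n)"
proof -
  have "sumsq_dev n = (\<lambda>X. \<Sum>i<n. (X i - (\<Sum>j<n. X j) / real n)\<^sup>2)"
    by (auto simp: sumsq_dev_def)
  then show ?thesis by simp
qed

lemma AE_cube_Icc: "AE X in cube n. \<forall>i<n. 0 \<le> X i \<and> X i \<le> 1"
proof -
  have "AE x in unif. 0 \<le> x \<and> x \<le> 1"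
    by (rule AE_uniform_measureI) auto
  then have "AE X in cube n. 0 \<le> X i \<and> X i \<le> 1" if "i < n" for i
    using that prob_space_unif by (intro AE_PiM_component) auto
  then have "AE X in cube n. \<forall>i\<in>{..<n}. 0 \<le> X i \<and> X i \<le> 1"
    by (intro AE_finite_allI) auto
  then show ?thesis by eventually_elim simp
qed

text \<open>With the other coordinates fixed, a level set is the root set of a quadratic in
  coordinate 0, hence finite and null; integrating coordinate 0 first gives the claim. It removes
  the jump points of the sawtooth, which arise at \<open>c = 0\<close> and
  \<open>c = x\<close>.\<close>

lemma AE_sumsq_dev_neq:
  assumes "n \<ge> 2"
  shows "AE X in cube n. sumsq_dev n X \<noteq> c"
proof -
  interpret product_prob_space "\<lambda>i::nat. unif" by (rule product_prob_space_unif)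
  define J where "J = {1..<n}"
  have J: "{..<n} = insert 0 J" "0 \<notin> J" "finite J" using assms by (auto simp: J_def)
  have m: "(\<lambda>X. indicator {X \<in> space (cube n). sumsq_dev n X = c} X :: ennreal) \<in> borel_measurable (cube n)"
    by measurable
  have "emeasure (cube n) {X \<in> space (cube n). sumsq_dev n X = c}
     = (\<integral>\<^sup>+X. indicator {X \<in> space (cube n). sumsq_dev n X = c} X \<partial>cube n)"
    by simp
  also have "\<dots> = (\<integral>\<^sup>+x. (\<integral>\<^sup>+y. indicator {X \<in> space (cube n). sumsq_dev n X = c} (x(0 := y)) \<partial>unif) \<partial>(\<Pi>\<^sub>M i\<in>J. unif))"
    using product_nn_integral_insert[OF J(3,2), of "\<lambda>X. indicator {X \<in> space (cube n). sumsq_dev n X = c} X"] m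
    unfolding J(1) by simp
  also have "\<dots> = (\<integral>\<^sup>+x. 0 \<partial>(\<Pi>\<^sub>M i\<in>J. unif))"
  proof (intro nn_integral_cong)
    fix x :: "nat \<Rightarrow> real"
    define \<alpha> \<beta> \<gamma> where "\<alpha> = 1 - 1 / real n" and "\<beta> = 2 * (\<Sum>j\<in>{..<n} - {0}. x j) / real n"
      and "\<gamma> = (\<Sum>j\<in>{..<n} - {0}. (x j)\<^sup>2) - (\<Sum>j\<in>{..<n} - {0}. x j)\<^sup>2 / real n"
    have f: "sumsq_dev n (x(0 := v)) = \<alpha> * v\<^sup>2 - \<beta> * v + \<gamma>" for v
      using assms unfolding \<alpha>_def \<beta>_def \<gamma>_def by (intro sumsq_dev_upd) auto
    have "\<alpha> \<noteq> 0" using assms by (simp add: \<alpha>_def)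
    \<comment> \<open>Coefficients are listed from the constant term upwards, so \<alpha> is the
      leading one.\<close>
    have "finite {y. poly [:\<gamma> - c, - \<beta>, \<alpha>:] y = 0}"
      by (rule poly_roots_finite) (use \<open>\<alpha> \<noteq> 0\<close> in auto)
    also have "{y. poly [:\<gamma> - c, - \<beta>, \<alpha>:] y = 0} = {y. sumsq_dev n (x(0 := y)) = c}"
      unfolding f by (auto simp: power2_eq_square algebra_simps)
    finally have fin: "finite {y. sumsq_dev n (x(0 := y)) = c}" .
    have "AE y in lborel. y \<notin> {y. sumsq_dev n (x(0 := y)) = c}"
      by (rule AE_not_in) (use fin in \<open>auto intro: finite_imp_null_set_lborel\<close>)
    then have "AE y in unif. y \<notin> {y. sumsq_dev n (x(0 := y)) = c}"
      by (intro AE_uniform_measureI) auto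
    then have "(\<integral>\<^sup>+y. indicator {X \<in> space (cube n). sumsq_dev n X = c} (x(0 := y)) \<partial>unif) = (\<integral>\<^sup>+y. 0 \<partial>unif)"
      by (intro nn_integral_cong_AE) (auto elim!: eventually_mono simp: indicator_def)
    then show "(\<integral>\<^sup>+y. indicator {X \<in> space (cube n). sumsq_dev n X = c} (x(0 := y)) \<partial>unif) = 0"
      by simp
  qed
  finally have "emeasure (cube n) {X \<in> space (cube n). sumsq_dev n X = c} = 0" by simp
  then show ?thesis by (intro AE_I[where N = "{X \<in> space (cube n). sumsq_dev n X = c}"]) auto
qed

section \<open>Abel summation of the sawtooth series\<close>

text \<open>Closed form of the Abel means of the sawtooth series. From the logarithm both the
  uniform bound and the boundary limit can be read off.\<close>

definition abel_saw :: "real \<Rightarrow> real \<Rightarrow> real" where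
  "abel_saw r \<theta> = - Im (Ln (1 - complex_of_real r * cis \<theta>))"

lemma abel_saw_sums:
  assumes "0 \<le> r" "r < 1"
  shows "(\<lambda>k. r ^ Suc k * sin (real (Suc k) * \<theta>) / real (Suc k)) sums abel_saw r \<theta>"
proof -
  define w where "w = complex_of_real r * cis \<theta>"
  have "norm w < 1" using assms by (simp add: w_def norm_mult)
  then have "(\<lambda>n. (- 1) ^ Suc n / complex_of_nat n * (- w) ^ n) sums Ln (1 + - w)"
    by (intro Ln_series) simp
  also have "(\<lambda>n. (- 1) ^ Suc n / complex_of_nat n * (- w) ^ n) = (\<lambda>n. - (w ^ n / complex_of_nat n))"
  proof
    fix n
    have "(- 1) ^ n * (- w) ^ n = w ^ n" by (simp flip: power_mult_distrib)
    then have "(- 1) ^ Suc n * (- w) ^ n = - (w ^ n)" by simp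
    then show "(- 1) ^ Suc n / complex_of_nat n * (- w) ^ n = - (w ^ n / complex_of_nat n)"
      by (simp only: times_divide_eq_left minus_divide_left)
  qed
  finally have "(\<lambda>n. w ^ n / complex_of_nat n) sums - Ln (1 - w)"
    using sums_minus by fastforce
  then have "(\<lambda>n. Im (w ^ n / complex_of_nat n)) sums Im (- Ln (1 - w))"
    by (rule sums_Im)
  then have "(\<lambda>n. Im (w ^ n / complex_of_nat n)) sums abel_saw r \<theta>"
    by (simp add: abel_saw_def w_def)
  also have "(\<lambda>n. Im (w ^ n / complex_of_nat n)) = (\<lambda>n. r ^ n * sin (real n * \<theta>) / real n)"
    by (rule ext) (simp add: w_def power_mult_distrib Complex.DeMoivre Im_divide_of_nat flip: of_real_power)
  \<comment> \<open>The term of index 0 is 0, so the series may start at index 1.\<close>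
  finally show ?thesis
    using sums_Suc_iff[of "\<lambda>n. r ^ n * sin (real n * \<theta>) / real n" "abel_saw r \<theta>"] by simp
qed

lemma abel_saw_minus:
  assumes "0 \<le> r" "r < 1"
  shows "abel_saw r (- \<theta>) = - abel_saw r \<theta>"
proof -
  have "(\<lambda>k. r ^ Suc k * sin (real (Suc k) * - \<theta>) / real (Suc k)) sums (- abel_saw r \<theta>)"
    using sums_minus[OF abel_saw_sums[OF assms, of \<theta>]] by simp
  then show ?thesis by (rule sums_unique2[OF abel_saw_sums[OF assms]])
qed

text \<open>For \<open>r < 1\<close> the point \<open>1 - r * cis \<theta>\<close> lies in the open
  right half-plane, so its argument is below \<open>pi / 2\<close> in modulus. The bound does not
  depend on \<open>r\<close>, which supplies the majorant for the limit
  \<open>r \<rightarrow> 1\<close>.\<close>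

lemma abs_abel_saw_le:
  assumes "0 \<le> r" "r < 1"
  shows "\<bar>abel_saw r \<theta>\<bar> \<le> pi / 2"
proof -
  have "r * cos \<theta> \<le> r * 1" using assms by (intro mult_left_mono) auto
  then have "0 < Re (1 - complex_of_real r * cis \<theta>)" using assms by simp
  from Re_Ln_pos_lt_imp[OF this] show ?thesis by (simp add: abel_saw_def)
qed

text \<open>In polar form \<open>1 - cis \<theta>\<close> has modulus
  \<open>2 * sin (\<theta> / 2)\<close> and argument \<open>(\<theta> - pi) / 2\<close>, and the
  principal logarithm is continuous there.\<close>

lemma abel_saw_tendsto:
  assumes "0 < \<theta>" "\<theta> < 2 * pi" and X: "X \<longlonglongrightarrow> 1"
  shows "(\<lambda>m. abel_saw (X m) \<theta>) \<longlonglongrightarrow> (pi - \<theta>) / 2"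
proof -
  have s: "sin (\<theta> / 2) > 0" using assms by (intro sin_gt_zero) auto
  have dbl: "cos \<theta> = 1 - 2 * (sin (\<theta> / 2))\<^sup>2" "sin \<theta> = 2 * sin (\<theta> / 2) * cos (\<theta> / 2)"
    using cos_double_sin[of "\<theta> / 2"] sin_double[of "\<theta> / 2"] by simp_all
  define v where "v = Complex (ln (2 * sin (\<theta> / 2))) ((\<theta> - pi) / 2)"
  have "exp v = 1 - cis \<theta>"
    using s by (simp add: v_def exp_eq_polar complex_eq_iff dbl diff_divide_distrib cos_diff sin_diff power2_eq_square
      flip: exp_of_real)
  then have "Ln (1 - cis \<theta>) = v"
    using assms by (intro Ln_unique) (auto simp: v_def)
  moreover have "(\<lambda>m. Ln (1 - complex_of_real (X m) * cis \<theta>)) \<longlonglongrightarrow> Ln (1 - complex_of_real 1 * cis \<theta>)"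
  proof (intro tendsto_intros X)
    have "Re (1 - complex_of_real 1 * cis \<theta>) > 0" using s by (simp add: dbl)
    then show "1 - complex_of_real 1 * cis \<theta> \<notin> \<real>\<^sub>\<le>\<^sub>0"
      using complex_nonpos_Reals_iff by force
  qed
  ultimately have "(\<lambda>m. - Im (Ln (1 - complex_of_real (X m) * cis \<theta>))) \<longlonglongrightarrow> - Im v"
    by (intro tendsto_intros) auto
  moreover have "- Im v = (pi - \<theta>) / 2" by (simp add: v_def field_simps)
  ultimately show ?thesis by (simp add: abel_saw_def)
qed

text \<open>By the product formula for \<open>sin * cos\<close> this combination is the Abel mean of
  the series with terms \<open>sin (k * a) * (1 - cos (k * b)) / k\<close>; its limit is a step
  function of \<open>a\<close> with jump at \<open>b\<close>.\<close>

definition abel_step :: "real \<Rightarrow> real \<Rightarrow> real \<Rightarrow> real" where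
  "abel_step r a b = abel_saw r a - (abel_saw r (a + b) + abel_saw r (a - b)) / 2"

lemma abel_step_sums:
  assumes "0 \<le> r" "r < 1"
  shows "(\<lambda>k. r ^ Suc k * (sin (real (Suc k) * a) * (1 - cos (real (Suc k) * b)) / real (Suc k))) sums abel_step r a b"
proof -
  have "(\<lambda>k. r ^ Suc k * sin (real (Suc k) * a) / real (Suc k) -
          (r ^ Suc k * sin (real (Suc k) * (a + b)) / real (Suc k) + r ^ Suc k * sin (real (Suc k) * (a - b)) / real (Suc k)) / 2)
        sums abel_step r a b"
    unfolding abel_step_def by (intro sums_diff sums_divide sums_add abel_saw_sums assms)
  also have "(\<lambda>k. r ^ Suc k * sin (real (Suc k) * a) / real (Suc k) -
          (r ^ Suc k * sin (real (Suc k) * (a + b)) / real (Suc k) + r ^ Suc k * sin (real (Suc k) * (a - b)) / real (Suc k)) / 2)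
     = (\<lambda>k. r ^ Suc k * (sin (real (Suc k) * a) * (1 - cos (real (Suc k) * b)) / real (Suc k)))"
  proof
    fix k
    define m where "m = real (Suc k)"
    have "m > 0" by (simp add: m_def)
    have "sin (m * (a + b)) + sin (m * (a - b)) = 2 * sin (m * a) * cos (m * b)"
      by (simp add: distrib_left right_diff_distrib sin_add sin_diff)
    then have "r ^ Suc k * sin (m * a) / m - (r ^ Suc k * sin (m * (a + b)) / m + r ^ Suc k * sin (m * (a - b)) / m) / 2
       = r ^ Suc k * (sin (m * a) * (1 - cos (m * b)) / m)"
      using \<open>m > 0\<close> by (simp add: field_simps flip: distrib_left)
    then show "r ^ Suc k * sin (real (Suc k) * a) / real (Suc k) -
          (r ^ Suc k * sin (real (Suc k) * (a + b)) / real (Suc k) + r ^ Suc k * sin (real (Suc k) * (a - b)) / real (Suc k)) / 2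
        = r ^ Suc k * (sin (real (Suc k) * a) * (1 - cos (real (Suc k) * b)) / real (Suc k))"
      unfolding m_def .
  qed
  finally show ?thesis .
qed

lemma abs_abel_step_le:
  assumes "0 \<le> r" "r < 1"
  shows "\<bar>abel_step r a b\<bar> \<le> pi"
  using abs_abel_saw_le[OF assms, of a] abs_abel_saw_le[OF assms, of "a + b"] abs_abel_saw_le[OF assms, of "a - b"]
  unfolding abel_step_def abs_le_iff by (simp add: field_simps)

text \<open>The linear parts of the three sawtooth values cancel. For \<open>a < b\<close> the
  argument \<open>a - b\<close> has crossed the jump of height \<open>pi\<close> at 0, and half of
  that jump remains. The ranges of \<open>a\<close> and \<open>b\<close> keep \<open>a + b\<close>
  below \<open>2 * pi\<close>.\<close>

lemma abel_step_tendsto: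
  assumes "0 < a" "a \<le> pi" "0 \<le> b" "b < pi" "a \<noteq> b"
    and X: "X \<longlonglongrightarrow> 1" "\<And>m. 0 \<le> X m" "\<And>m. X m < 1"
  shows "(\<lambda>m. abel_step (X m) a b) \<longlonglongrightarrow> (if a < b then pi / 2 else 0)"
proof -
  have d: "(\<lambda>m. abel_saw (X m) (a - b)) \<longlonglongrightarrow> (if a < b then - ((pi - (b - a)) / 2) else (pi - (a - b)) / 2)"
  proof (cases "a < b")
    case True
    have "(\<lambda>m. - abel_saw (X m) (b - a)) \<longlonglongrightarrow> - ((pi - (b - a)) / 2)"
      using True assms by (intro tendsto_minus abel_saw_tendsto) auto
    then show ?thesis using True abel_saw_minus[OF X(2,3), where \<theta> = "b - a"] by simp
  qed (use assms in \<open>auto intro!: abel_saw_tendsto\<close>)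
  have "(\<lambda>m. abel_step (X m) a b) \<longlonglongrightarrow>
      (pi - a) / 2 - ((pi - (a + b)) / 2 + (if a < b then - ((pi - (b - a)) / 2) else (pi - (a - b)) / 2)) / 2"
    unfolding abel_step_def using assms by (intro tendsto_intros d abel_saw_tendsto) auto
  also have "(pi - a) / 2 - ((pi - (a + b)) / 2 + (if a < b then - ((pi - (b - a)) / 2) else (pi - (a - b)) / 2)) / 2
     = (if a < b then pi / 2 else 0)"
    by (simp add: field_simps)
  finally show ?thesis .
qed

text \<open>Abel's limit theorem for absolutely convergent series, obtained as dominated convergence
  for counting measure.\<close>

lemma abel_sum_tendsto:
  fixes c :: "nat \<Rightarrow> real"
  assumes c: "summable (\<lambda>k. \<bar>c k\<bar>)" and X: "X \<longlonglongrightarrow> 1" "\<And>m. 0 \<le> X m" "\<And>m. X m < 1"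
  shows "(\<lambda>m. \<Sum>k. X m ^ Suc k * c k) \<longlonglongrightarrow> (\<Sum>k. c k)"
proof -
  have le: "\<bar>X m ^ Suc k * c k\<bar> \<le> \<bar>c k\<bar>" for m k
  proof -
    have "X m ^ Suc k \<le> 1" using X(2,3) by (intro power_le_one) (auto intro: less_imp_le)
    then show ?thesis using X(2)[of m] by (simp add: abs_mult mult_left_le_one_le del: power_Suc)
  qed
  have int: "integrable (count_space UNIV) c" using c by (simp add: integrable_count_space_nat_iff)
  have "(\<lambda>m. \<integral>k. X m ^ Suc k * c k \<partial>count_space UNIV) \<longlonglongrightarrow> (\<integral>k. c k \<partial>count_space UNIV)"
  proof (rule integral_dominated_convergence[where w = "\<lambda>k. \<bar>c k\<bar>"])
    have "(\<lambda>m. X m ^ Suc k * c k) \<longlonglongrightarrow> 1 ^ Suc k * c k" for k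
      by (intro tendsto_intros X)
    then show "AE k in count_space UNIV. (\<lambda>m. X m ^ Suc k * c k) \<longlonglongrightarrow> c k" by simp
    show "AE k in count_space UNIV. norm (X m ^ Suc k * c k) \<le> \<bar>c k\<bar>" for m
      using le by simp
  qed (use int in auto)
  moreover have "(\<integral>k. X m ^ Suc k * c k \<partial>count_space UNIV) = (\<Sum>k. X m ^ Suc k * c k)" for m
  proof (rule integral_count_space_nat)
    show "integrable (count_space UNIV) (\<lambda>k. X m ^ Suc k * c k)"
      by (rule Bochner_Integration.integrable_bound[OF int]) (use le in auto)
  qed
  ultimately show ?thesis using int by (simp add: integral_count_space_nat)
qed

text \<open>For fixed \<open>r < 1\<close> the geometric factor permits exchanging expectation and
  sum. As \<open>r \<rightarrow> 1\<close> the expectation converges because the Abel means are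
  bounded by \<open>pi\<close>, and the series converges because \<open>c\<close> is absolutely
  summable; the two limits are compared.\<close>

lemma (in prob_space) prob_less_sine_series:
  fixes A :: "'a \<Rightarrow> real"
  assumes A: "A \<in> borel_measurable M" and b: "0 \<le> b" "b < pi"
    and rng: "AE \<omega> in M. 0 < A \<omega> \<and> A \<omega> \<le> pi \<and> A \<omega> \<noteq> b"
  defines "c \<equiv> \<lambda>k. expectation (\<lambda>\<omega>. sin (real (Suc k) * A \<omega>)) * (1 - cos (real (Suc k) * b)) / real (Suc k)"
  assumes c: "summable (\<lambda>k. \<bar>c k\<bar>)"
  shows "prob {\<omega> \<in> space M. A \<omega> \<le> b} = 2 / pi * (\<Sum>k. c k)"
proof -
  note A[measurable]
  define X where "X = (\<lambda>m. 1 - 1 / real (Suc m))"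
  have X: "X \<longlonglongrightarrow> 1" "\<And>m. 0 \<le> X m" "\<And>m. X m < 1"
    using tendsto_diff[OF tendsto_const[of 1] LIMSEQ_inverse_real_of_nat] by (simp_all add: X_def inverse_eq_divide)
  have E: "expectation (\<lambda>\<omega>. abel_step (X m) (A \<omega>) b) = (\<Sum>k. X m ^ Suc k * c k)" 
      and meas: "(\<lambda>\<omega>. abel_step (X m) (A \<omega>) b) \<in> borel_measurable M" for m
  proof -
    define f where "f = (\<lambda>k \<omega>. X m ^ Suc k * (sin (real (Suc k) * A \<omega>) * (1 - cos (real (Suc k) * b)) / real (Suc k)))"
    have f_sum: "(\<lambda>k. f k \<omega>) sums abel_step (X m) (A \<omega>) b" for \<omega>
      unfolding f_def by (rule abel_step_sums[OF X(2,3)])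
    have fm[measurable]: "f k \<in> borel_measurable M" for k unfolding f_def by measurable
    have fb: "norm (f k \<omega>) \<le> X m ^ k * 2" for k \<omega>
    proof -
      have "\<bar>sin (real (Suc k) * A \<omega>)\<bar> * \<bar>1 - cos (real (Suc k) * b)\<bar> \<le> 1 * 2"
        using cos_le_one[of "real (Suc k) * b"] cos_ge_minus_one[of "real (Suc k) * b"]
        by (intro mult_mono) (simp_all del: of_nat_Suc cos_le_one cos_ge_minus_one)
      then have "\<bar>sin (real (Suc k) * A \<omega>)\<bar> * \<bar>1 - cos (real (Suc k) * b)\<bar> / real (Suc k) \<le> 2"
        by (simp add: divide_le_eq)
      moreover have "X m ^ Suc k \<le> X m ^ k" using X(2)[of m] X(3)[of m] by (intro power_decreasing) auto
      ultimately have "X m ^ Suc k * (\<bar>sin (real (Suc k) * A \<omega>)\<bar> * \<bar>1 - cos (real (Suc k) * b)\<bar> / real (Suc k)) \<le> X m ^ k * 2"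
        using X(2)[of m] by (intro mult_mono) (simp_all del: power_Suc of_nat_Suc)
      then show ?thesis using X(2)[of m]
        by (simp add: f_def abs_mult power_abs del: power_Suc of_nat_Suc)
    qed
    have geo: "summable (\<lambda>k. X m ^ k * 2)"
      using X(2)[of m] X(3)[of m] by (intro summable_mult2 summable_geometric) auto
    have fi: "integrable M (f k)" for k
      by (rule integrable_const_bound[of _ "X m ^ k * 2"]) (use fb in auto)
    show "(\<lambda>\<omega>. abel_step (X m) (A \<omega>) b) \<in> borel_measurable M"
      unfolding sums_unique[OF f_sum] by measurable
    have "expectation (\<lambda>\<omega>. \<Sum>k. f k \<omega>) = (\<Sum>k. expectation (f k))"
    proof (rule integral_suminf[OF fi])
      show "AE \<omega> in M. summable (\<lambda>k. norm (f k \<omega>))"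
        by (intro AE_I2 summable_comparison_test'[OF geo]) (use fb in auto)
      show "summable (\<lambda>k. expectation (\<lambda>\<omega>. norm (f k \<omega>)))"
      proof (rule summable_comparison_test'[OF geo])
        fix k
        have "expectation (\<lambda>\<omega>. norm (f k \<omega>)) \<le> expectation (\<lambda>\<omega>. X m ^ k * 2)"
          by (intro integral_mono) (use fb fi in auto)
        then show "norm (expectation (\<lambda>\<omega>. norm (f k \<omega>))) \<le> X m ^ k * 2"
          by (simp add: prob_space abs_of_nonneg Bochner_Integration.integral_nonneg)
      qed
    qed
    moreover have "expectation (f k) = X m ^ Suc k * c k" for k
      by (simp add: f_def c_def del: power_Suc of_nat_Suc)
    ultimately show "expectation (\<lambda>\<omega>. abel_step (X m) (A \<omega>) b) = (\<Sum>k. X m ^ Suc k * c k)"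
      using sums_unique[OF f_sum] by simp
  qed
  have "(\<lambda>m. expectation (\<lambda>\<omega>. abel_step (X m) (A \<omega>) b))
      \<longlonglongrightarrow> expectation (\<lambda>\<omega>. if A \<omega> < b then pi / 2 else 0)"
  proof (rule integral_dominated_convergence[where w = "\<lambda>_. pi"])
    show "AE \<omega> in M. (\<lambda>m. abel_step (X m) (A \<omega>) b) \<longlonglongrightarrow> (if A \<omega> < b then pi / 2 else 0)"
      using rng by eventually_elim (rule abel_step_tendsto, use b X in auto)
  qed (use meas abs_abel_step_le[OF X(2,3)] in auto)
  then have "expectation (\<lambda>\<omega>. if A \<omega> < b then pi / 2 else 0) = (\<Sum>k. c k)"
    unfolding E using LIMSEQ_unique abel_sum_tendsto[OF c X] by blast
  \<comment> \<open>Strict and weak inequality give almost surely the same event, because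
    \<open>A\<close> avoids \<open>b\<close>.\<close>
  moreover have "expectation (\<lambda>\<omega>. if A \<omega> < b then pi / 2 else 0)
      = expectation (\<lambda>\<omega>. pi / 2 * indicator {\<omega> \<in> space M. A \<omega> \<le> b} \<omega>)"
  proof (rule integral_cong_AE)
    show "AE \<omega> in M. (if A \<omega> < b then pi / 2 else 0) = pi / 2 * indicator {\<omega> \<in> space M. A \<omega> \<le> b} \<omega>"
      using rng AE_space by eventually_elim (auto simp: indicator_def)
  qed auto
  ultimately show ?thesis by (simp add: field_simps)
qed

section \<open>The Laplace transform of the statistic\<close>

lemma gauss_integral:
  fixes a c :: real
  assumes "a > 0"
  shows "integrable lborel (\<lambda>m. exp (- (a * (m - c)\<^sup>2)))"
    and "(\<integral>m. exp (- (a * (m - c)\<^sup>2)) \<partial>lborel) = sqrt (pi / a)"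
proof -
  \<comment> \<open>The Gaussian is a multiple of the normal density with mean \<open>c\<close> and
    variance \<open>1 / (2 * a)\<close>.\<close>
  have "(\<lambda>m. exp (- (a * (m - c)\<^sup>2))) = (\<lambda>m. sqrt (pi / a) * normal_density c (sqrt (1 / (2 * a))) m)"
  proof
    fix m
    show "exp (- (a * (m - c)\<^sup>2)) = sqrt (pi / a) * normal_density c (sqrt (1 / (2 * a))) m"
      using assms by (simp add: normal_density_def field_simps)
  qed
  moreover have "sqrt (1 / (2 * a)) > 0" using assms by simp
  ultimately show "integrable lborel (\<lambda>m. exp (- (a * (m - c)\<^sup>2)))"
    and "(\<integral>m. exp (- (a * (m - c)\<^sup>2)) \<partial>lborel) = sqrt (pi / a)"
    by simp_all
qed

lemma integral_unif:
  fixes f :: "real \<Rightarrow> 'a::{banach, second_countable_topology}"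
  assumes [measurable]: "f \<in> borel_measurable borel"
  shows "(\<integral>x. f x \<partial>unif) = (LBINT x:{0..1}. f x)"
proof -
  have "unif = density lborel (\<lambda>x. ennreal (indicator {0..1} x))"
    by (simp add: uniform_measure_def ennreal_indicator divide_ennreal_def)
  then show ?thesis by (simp add: integral_density set_lebesgue_integral_def)
qed

text \<open>The contribution of one coordinate once the mean has been replaced by a free variable
  \<open>m\<close>; by independence the joint expectation over the cube is its \<open>n\<close>-th
  power.\<close>

definition smear :: "real \<Rightarrow> real \<Rightarrow> real" where
  "smear s m = (\<integral>x. exp (- (s * (x - m))\<^sup>2) \<partial>unif)"

lemma smear_measurable [measurable]: "smear s \<in> borel_measurable borel"
proof -
  interpret prob_space unif by (rule prob_space_unif)
  show ?thesis unfolding smear_def by measurable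
qed

lemma smear_nonneg: "smear s m \<ge> 0"
  unfolding smear_def by simp

text \<open>The substitution \<open>w = s * (x - m)\<close> carries the unit interval to the segment
  from \<open>- s * m\<close> to \<open>s * (1 - m)\<close>; oddness of \<open>cerf\<close> turns
  the difference of endpoint values into a sum.\<close>

lemma smear_cerf:
  assumes "s > 0"
  shows "complex_of_real (smear s m) = complex_of_real (sqrt pi / (2 * s)) *
    (cerf (complex_of_real (s * (1 - m))) + cerf (complex_of_real (s * m)))"
proof -
  have int: "set_integrable lborel {0..1} (\<lambda>x::real. exp (- (s * (x - m))\<^sup>2))"
    by (intro borel_integrable_atLeastAtMost' continuous_intros)
  have cint: "(\<lambda>x::real. exp (- (s * (x - m))\<^sup>2)) integrable_on {0..1}"
    by (intro integrable_continuous_real continuous_intros)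
  have "smear s m = integral {0..1} (\<lambda>x. exp (- (s * (x - m))\<^sup>2))"
    unfolding smear_def by (subst integral_unif) (use int in \<open>auto intro: set_borel_integral_eq_integral(2)\<close>)
  then have 1: "complex_of_real (smear s m) = integral {0..1} (\<lambda>x. complex_of_real (exp (- (s * (x - m))\<^sup>2)))"
    using integral_linear[OF cint bounded_linear_of_real[where 'a = complex]] by (simp add: o_def)
  have "cerf (complex_of_real (s * (1 - m))) + cerf (complex_of_real (s * m))
      = cerf (complex_of_real (s * (1 - m))) - cerf (complex_of_real (- s * m))"
    using cerf_minus[of "complex_of_real (s * m)"] by simp
  also have "\<dots> = 2 / complex_of_real (sqrt pi) * (complex_of_real (s * (1 - m)) - complex_of_real (- s * m)) *
      integral {0..1} (\<lambda>r. exp (- ((complex_of_real (- s * m) + complex_of_real r * (complex_of_real (s * (1 - m)) - complex_of_real (- s * m)))\<^sup>2)))"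
    by (rule cerf_diff_integral)
  also have "complex_of_real (s * (1 - m)) - complex_of_real (- s * m) = complex_of_real s"
    by (simp add: algebra_simps)
  also have "(\<lambda>r. exp (- ((complex_of_real (- s * m) + complex_of_real r * complex_of_real s)\<^sup>2)))
      = (\<lambda>x. complex_of_real (exp (- (s * (x - m))\<^sup>2)))"
  proof
    fix r
    have "complex_of_real (- s * m) + complex_of_real r * complex_of_real s = complex_of_real (s * (r - m))"
      by (simp add: algebra_simps)
    then show "exp (- ((complex_of_real (- s * m) + complex_of_real r * complex_of_real s)\<^sup>2))
        = complex_of_real (exp (- (s * (r - m))\<^sup>2))"
      by (simp only: exp_of_real of_real_minus of_real_power flip: exp_of_real)
  qed
  finally have "cerf (complex_of_real (s * (1 - m))) + cerf (complex_of_real (s * m))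
      = 2 / complex_of_real (sqrt pi) * complex_of_real s * complex_of_real (smear s m)"
    unfolding 1 .
  then show ?thesis using assms by (simp add: field_simps)
qed

lemma smear_reflect: "s > 0 \<Longrightarrow> smear s (1 - m) = smear s m"
proof -
  assume "s > 0"
  then have "complex_of_real (smear s (1 - m)) = complex_of_real (smear s m)"
    unfolding smear_cerf[OF \<open>s > 0\<close>] by simp
  then show ?thesis by (simp only: of_real_eq_iff)
qed

text \<open>The integral of \<open>exp (- s^2 * (\<Sum>i<n. (X i - m)^2))\<close> over
  \<open>X\<close> and \<open>m\<close> is computed in both orders. Integrating \<open>X\<close>
  first factorises it; integrating \<open>m\<close> first leaves a Gaussian of mass
  \<open>sqrt (pi / (s^2 * n))\<close> times the Laplace integrand.\<close>

lemma sumsq_dev_laplace_smear: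
  assumes n: "n > 0" and s: "s > 0"
  shows "integrable lborel (\<lambda>m. smear s m ^ n)"
    and "(\<integral>m. smear s m ^ n \<partial>lborel) = sqrt pi / (s * sqrt (real n)) * (\<integral>X. exp (- (s\<^sup>2 * sumsq_dev n X)) \<partial>cube n)"
proof -
  interpret U: prob_space unif by (rule prob_space_unif)
  interpret C: prob_space "cube n" by (rule prob_space_cube)
  interpret product_prob_space "\<lambda>i::nat. unif" by (rule product_prob_space_unif)
  interpret P: pair_sigma_finite "cube n" "lborel :: real measure" ..
  have expint: "integrable (cube n) (\<lambda>X. exp (- (s\<^sup>2 * sumsq_dev n X)))"
    by (rule C.integrable_const_bound[of _ 1]) (use sumsq_dev_nonneg in auto)
  have gint: "integrable unif (\<lambda>x. exp (- (s * (x - m))\<^sup>2))" for m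
    by (rule U.integrable_const_bound[of _ 1]) auto
  \<comment> \<open>With values in \<open>ennreal\<close> Tonelli comes first, and integrability of
    \<open>smear s m ^ n\<close> is then read off the finite value of the other iterated
    integral.\<close>
  define f where "f = (\<lambda>(X :: nat \<Rightarrow> real) (m::real). ennreal (\<Prod>i<n. exp (- (s * (X i - m))\<^sup>2)))"
  have fm: "case_prod f \<in> borel_measurable (cube n \<Otimes>\<^sub>M lborel)"
    unfolding f_def case_prod_beta by measurable
  have "(\<integral>\<^sup>+m. (\<integral>\<^sup>+X. f X m \<partial>cube n) \<partial>lborel) = (\<integral>\<^sup>+X. (\<integral>\<^sup>+m. f X m \<partial>lborel) \<partial>cube n)"
    using P.Fubini'[OF fm] .
  moreover have "(\<integral>\<^sup>+X. f X m \<partial>cube n) = ennreal (smear s m ^ n)" for m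
  proof -
    have "(\<integral>\<^sup>+X. f X m \<partial>cube n) = (\<integral>\<^sup>+X. (\<Prod>i<n. ennreal (exp (- (s * (X i - m))\<^sup>2))) \<partial>cube n)"
      unfolding f_def by (simp add: prod_ennreal)
    also have "\<dots> = (\<Prod>i<n. \<integral>\<^sup>+x. ennreal (exp (- (s * (x - m))\<^sup>2)) \<partial>unif)"
      by (rule product_nn_integral_prod) auto
    also have "\<dots> = ennreal (smear s m) ^ n"
      using gint by (simp add: nn_integral_eq_integral smear_def)
    finally show ?thesis by (simp add: ennreal_power smear_nonneg)
  qed
  moreover have "(\<integral>\<^sup>+m. f X m \<partial>lborel) = ennreal (sqrt pi / (s * sqrt (real n)) * exp (- (s\<^sup>2 * sumsq_dev n X)))" for X
  proof -
    define c where "c = (\<Sum>i<n. X i) / real n"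
    have a: "s\<^sup>2 * real n > 0" using n s by simp
    have "f X m = ennreal (exp (- (s\<^sup>2 * sumsq_dev n X)) * exp (- (s\<^sup>2 * real n * (m - c)\<^sup>2)))" for m
    proof -
      have "(\<Prod>i<n. exp (- (s * (X i - m))\<^sup>2)) = exp (\<Sum>i<n. - (s * (X i - m))\<^sup>2)"
        by (simp add: exp_sum)
      also have "(\<Sum>i<n. - (s * (X i - m))\<^sup>2) = - (s\<^sup>2 * (\<Sum>i<n. (X i - m)\<^sup>2))"
        by (simp add: power_mult_distrib sum_negf sum_distrib_left)
      also have "(\<Sum>i<n. (X i - m)\<^sup>2) = sumsq_dev n X + real n * (m - c)\<^sup>2"
        unfolding c_def by (rule sum_sq_shift_eq[OF n])
      finally show ?thesis by (simp add: f_def algebra_simps flip: exp_add)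
    qed
    then have "(\<integral>\<^sup>+m. f X m \<partial>lborel) = ennreal (\<integral>m. exp (- (s\<^sup>2 * sumsq_dev n X)) * exp (- (s\<^sup>2 * real n * (m - c)\<^sup>2)) \<partial>lborel)"
      using gauss_integral(1)[OF a, of c] by (simp add: nn_integral_eq_integral)
    also have "(\<integral>m. exp (- (s\<^sup>2 * sumsq_dev n X)) * exp (- (s\<^sup>2 * real n * (m - c)\<^sup>2)) \<partial>lborel)
        = exp (- (s\<^sup>2 * sumsq_dev n X)) * sqrt (pi / (s\<^sup>2 * real n))"
      by (subst integral_mult_right_zero) (simp only: gauss_integral(2)[OF a])
    also have "sqrt (pi / (s\<^sup>2 * real n)) = sqrt pi / (s * sqrt (real n))"
      using s by (simp add: real_sqrt_divide real_sqrt_mult)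
    finally show ?thesis by (simp add: mult.commute)
  qed
  ultimately have nn: "(\<integral>\<^sup>+m. ennreal (smear s m ^ n) \<partial>lborel)
      = ennreal (\<integral>X. sqrt pi / (s * sqrt (real n)) * exp (- (s\<^sup>2 * sumsq_dev n X)) \<partial>cube n)"
    using expint s by (simp add: nn_integral_eq_integral)
  show int: "integrable lborel (\<lambda>m. smear s m ^ n)"
    by (rule integrableI_nonneg) (use nn smear_nonneg in auto)
  have "ennreal (\<integral>m. smear s m ^ n \<partial>lborel) = ennreal (\<integral>X. sqrt pi / (s * sqrt (real n)) * exp (- (s\<^sup>2 * sumsq_dev n X)) \<partial>cube n)"
    unfolding nn[symmetric] using int smear_nonneg by (simp add: nn_integral_eq_integral)
  then have "(\<integral>m. smear s m ^ n \<partial>lborel) = (\<integral>X. sqrt pi / (s * sqrt (real n)) * exp (- (s\<^sup>2 * sumsq_dev n X)) \<partial>cube n)"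
    using s smear_nonneg by (subst (asm) ennreal_inj) (auto intro!: Bochner_Integration.integral_nonneg)
  then show "(\<integral>m. smear s m ^ n \<partial>lborel) = sqrt pi / (s * sqrt (real n)) * (\<integral>X. exp (- (s\<^sup>2 * sumsq_dev n X)) \<partial>cube n)"
    by simp
qed

text \<open>Symmetry about \<open>m = 1 / 2\<close> folds the line onto
  \<open>m \<ge> 1 / 2\<close>, which is cut at \<open>m = 1\<close>. Below the cut
  \<open>m = (1 + u) / 2\<close>, above it \<open>m = 1 + y / s\<close>; the Jacobians
  \<open>1 / 2\<close> and \<open>1 / s\<close> meet the factor 2 from folding.\<close>

lemma integral_smear_power:
  assumes n: "n > 0" and s: "s > 0"
  shows "(\<integral>m. smear s m ^ n \<partial>lborel) =
     2 / s * (LBINT y:{0..}. smear s (1 + y / s) ^ n) + (LBINT u:{0..1}. smear s ((1 + u) / 2) ^ n)"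
proof -
  note int = sumsq_dev_laplace_smear(1)[OF n s]
  define h where "h = (\<lambda>v. smear s (1 / 2 + v) ^ n)"
  have hint: "integrable lborel h"
    using lborel_integrable_real_affine[OF int, of 1 "1 / 2"] by (simp add: h_def)
  have hset: "integrable lborel (\<lambda>v. indicator A v *\<^sub>R h v)" if "A \<in> sets lborel" for A
    using integrable_mult_indicator[OF that hint] .
  have even: "h (- v) = h v" for v
    using smear_reflect[OF s, of "1 / 2 + v"] by (simp add: h_def)
  have "(\<integral>m. smear s m ^ n \<partial>lborel) = (\<integral>v. h v \<partial>lborel)"
    using lborel_integral_real_affine[of 1 "\<lambda>m. smear s m ^ n" "1 / 2"] by (simp add: h_def)
  also have "\<dots> = 2 * (\<integral>v. indicator {0..} v *\<^sub>R h v \<partial>lborel)"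
    using has_bochner_integral_even_function[OF has_bochner_integral_integrable[OF hset[of "{0..}"]] even]
    by (simp add: has_bochner_integral_integral_eq)
  also have "(\<integral>v. indicator {0..} v *\<^sub>R h v \<partial>lborel)
     = (\<integral>v. indicator {0..<1/2} v *\<^sub>R h v + indicator {1/2..} v *\<^sub>R h v \<partial>lborel)"
    by (intro Bochner_Integration.integral_cong) (auto simp: indicator_def)
  also have "\<dots> = (\<integral>v. indicator {0..<1/2} v *\<^sub>R h v \<partial>lborel) + (\<integral>v. indicator {1/2..} v *\<^sub>R h v \<partial>lborel)"
    by (intro Bochner_Integration.integral_add hset) auto
  also have "(\<integral>v. indicator {0..<1/2} v *\<^sub>R h v \<partial>lborel) = 1 / 2 * (LBINT u:{0..1}. smear s ((1 + u) / 2) ^ n)"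
  proof -
    have "(\<integral>v. indicator {0..<1/2} v *\<^sub>R h v \<partial>lborel) = 1 / 2 * (\<integral>u. indicator {0..<1/2} (u / 2) *\<^sub>R h (u / 2) \<partial>lborel)"
      using lborel_integral_real_affine[of "1 / 2" "\<lambda>v. indicator {0..<1/2} v *\<^sub>R h v" 0] by simp
    \<comment> \<open>The half-open interval misses only the endpoint \<open>u = 1\<close>, a null
      set.\<close>
    also have "(\<integral>u. indicator {0..<1/2} (u / 2) *\<^sub>R h (u / 2) \<partial>lborel) = (LBINT u:{0..1}. smear s ((1 + u) / 2) ^ n)"
      unfolding set_lebesgue_integral_def
    proof (rule integral_cong_AE)
      show "AE u in lborel. indicator {0..<1/2} (u / 2) *\<^sub>R h (u / 2) = indicator {0..1} u *\<^sub>R smear s ((1 + u) / 2) ^ n"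
        using AE_lborel_singleton[of "1::real"]
        by eventually_elim (auto simp: indicator_def h_def add_divide_distrib)
    qed (simp_all add: h_def)
    finally show ?thesis .
  qed
  also have "(\<integral>v. indicator {1/2..} v *\<^sub>R h v \<partial>lborel) = 1 / s * (LBINT y:{0..}. smear s (1 + y / s) ^ n)"
  proof -
    have "(\<integral>v. indicator {1/2..} v *\<^sub>R h v \<partial>lborel)
        = 1 / s * (\<integral>y. indicator {1/2..} (1 / 2 + y / s) *\<^sub>R h (1 / 2 + y / s) \<partial>lborel)"
      using lborel_integral_real_affine[of "1 / s" "\<lambda>v. indicator {1/2..} v *\<^sub>R h v" "1 / 2"] s by simp
    also have "(\<integral>y. indicator {1/2..} (1 / 2 + y / s) *\<^sub>R h (1 / 2 + y / s) \<partial>lborel)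
        = (LBINT y:{0..}. smear s (1 + y / s) ^ n)"
      unfolding set_lebesgue_integral_def using s
      by (intro Bochner_Integration.integral_cong) (auto simp: indicator_def h_def zero_le_divide_iff)
    finally show ?thesis .
  qed
  finally show ?thesis by (simp add: algebra_simps)
qed

section \<open>Continuation of the Laplace identity to complex parameters\<close>

definition outer_integral :: "nat \<Rightarrow> complex \<Rightarrow> complex" where
  "outer_integral n s = (LBINT y:{0..}. (cerf (complex_of_real y + s) - cerf (complex_of_real y)) ^ n)"

definition inner_integral :: "nat \<Rightarrow> complex \<Rightarrow> complex" where
  "inner_integral n s = (LBINT u:{0..1}. (cerf (1/2 * s * complex_of_real (u + 1)) - cerf (1/2 * s * complex_of_real (u - 1))) ^ n)"

text \<open>Each factor \<open>smear\<close> contributes \<open>sqrt pi / (2 * s)\<close>, so the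
  \<open>n\<close>-th power has a pole of order \<open>n\<close> at \<open>s = 0\<close>. The factor
  \<open>s ^ n\<close> clears it and leaves expressions that make sense and are entire for complex
  \<open>s\<close>.\<close>

lemma laplace_identity_pos:
  assumes n: "n > 0" and s: "s > 0"
  shows "complex_of_real s ^ n * (\<integral>X. exp (- ((complex_of_real s)\<^sup>2 * complex_of_real (sumsq_dev n X))) \<partial>cube n)
    = complex_of_real (sqrt (real n) / sqrt pi * (sqrt pi / 2) ^ n) *
      (2 * outer_integral n (complex_of_real s) + complex_of_real s * inner_integral n (complex_of_real s))"
proof -
  define k where "k = complex_of_real (sqrt pi / (2 * s)) ^ n"
  have O: "complex_of_real (LBINT y:{0..}. smear s (1 + y / s) ^ n) = k * outer_integral n (complex_of_real s)"
  proof -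
    have "complex_of_real (LBINT y:{0..}. smear s (1 + y / s) ^ n) = (LBINT y:{0..}. complex_of_real (smear s (1 + y / s) ^ n))"
      by (rule set_integral_complex_of_real[symmetric])
    also have "(\<lambda>y. complex_of_real (smear s (1 + y / s) ^ n))
       = (\<lambda>y. k * (cerf (complex_of_real y + complex_of_real s) - cerf (complex_of_real y)) ^ n)"
    proof
      fix y
      \<comment> \<open>At \<open>m = 1 + y / s\<close> the two arguments of \<open>cerf\<close> are
        \<open>- y\<close> and \<open>y + s\<close>, so oddness yields the difference in
        \<open>outer_integral\<close>.\<close>
      have e: "s * (1 - (1 + y / s)) = - y" "s * (1 + y / s) = y + s" using s by (auto simp: field_simps)
      show "complex_of_real (smear s (1 + y / s) ^ n) = k * (cerf (complex_of_real y + complex_of_real s) - cerf (complex_of_real y)) ^ n"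
        unfolding of_real_power smear_cerf[OF s] e
        by (simp only: power_mult_distrib k_def of_real_minus of_real_add cerf_minus) (simp add: k_def)
    qed
    finally show ?thesis by (simp add: outer_integral_def)
  qed
  have I: "complex_of_real (LBINT u:{0..1}. smear s ((1 + u) / 2) ^ n) = k * inner_integral n (complex_of_real s)"
  proof -
    have "complex_of_real (LBINT u:{0..1}. smear s ((1 + u) / 2) ^ n) = (LBINT u:{0..1}. complex_of_real (smear s ((1 + u) / 2) ^ n))"
      by (rule set_integral_complex_of_real[symmetric])
    also have "(\<lambda>u. complex_of_real (smear s ((1 + u) / 2) ^ n))
       = (\<lambda>u. k * (cerf (1/2 * complex_of_real s * complex_of_real (u + 1)) - cerf (1/2 * complex_of_real s * complex_of_real (u - 1))) ^ n)"
    proof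
      fix u
      have "cerf (complex_of_real (s * (1 - (1 + u) / 2))) = - cerf (1/2 * complex_of_real s * complex_of_real (u - 1))"
        by (subst cerf_minus[symmetric], rule arg_cong[of _ _ cerf]) (simp add: field_simps)
      moreover have "complex_of_real (s * ((1 + u) / 2)) = 1/2 * complex_of_real s * complex_of_real (u + 1)"
        by (simp add: field_simps)
      ultimately show "complex_of_real (smear s ((1 + u) / 2) ^ n) = k * (cerf (1/2 * complex_of_real s * complex_of_real (u + 1)) - cerf (1/2 * complex_of_real s * complex_of_real (u - 1))) ^ n"
        unfolding of_real_power smear_cerf[OF s] by (simp only: power_mult_distrib k_def) (simp add: k_def)
    qed
    finally show ?thesis by (simp add: inner_integral_def)
  qed
  have L: "(\<integral>X. exp (- ((complex_of_real s)\<^sup>2 * complex_of_real (sumsq_dev n X))) \<partial>cube n)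
     = complex_of_real (\<integral>X. exp (- (s\<^sup>2 * sumsq_dev n X)) \<partial>cube n)"
    by (simp flip: integral_complex_of_real exp_of_real)
  have "sqrt pi / (s * sqrt (real n)) * (\<integral>X. exp (- (s\<^sup>2 * sumsq_dev n X)) \<partial>cube n)
      = 2 / s * (LBINT y:{0..}. smear s (1 + y / s) ^ n) + (LBINT u:{0..1}. smear s ((1 + u) / 2) ^ n)"
    using sumsq_dev_laplace_smear(2)[OF n s] integral_smear_power[OF n s] by simp
  then have "(\<integral>X. exp (- (s\<^sup>2 * sumsq_dev n X)) \<partial>cube n)
      = sqrt (real n) / sqrt pi * (2 * (LBINT y:{0..}. smear s (1 + y / s) ^ n) + s * (LBINT u:{0..1}. smear s ((1 + u) / 2) ^ n))"
    using n s by (simp add: field_simps)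
  from arg_cong[OF this, of complex_of_real]
  have "complex_of_real (\<integral>X. exp (- (s\<^sup>2 * sumsq_dev n X)) \<partial>cube n)
     = complex_of_real (sqrt (real n) / sqrt pi) * (2 * (k * outer_integral n (complex_of_real s)) + complex_of_real s * (k * inner_integral n (complex_of_real s)))"
    unfolding of_real_mult of_real_add O I by simp
  then have "complex_of_real s ^ n * (\<integral>X. exp (- ((complex_of_real s)\<^sup>2 * complex_of_real (sumsq_dev n X))) \<partial>cube n)
     = complex_of_real (sqrt (real n) / sqrt pi) * (complex_of_real s ^ n * k) * (2 * outer_integral n (complex_of_real s) + complex_of_real s * inner_integral n (complex_of_real s))"
    unfolding L by (simp add: algebra_simps)
  moreover have "complex_of_real s ^ n * k = complex_of_real ((sqrt pi / 2) ^ n)"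
  proof -
    have "s ^ n * (sqrt pi / (2 * s)) ^ n = (sqrt pi / 2) ^ n"
      using s by (simp flip: power_mult_distrib)
    then show ?thesis by (simp only: k_def flip: of_real_power of_real_mult)
  qed
  ultimately show ?thesis by simp
qed

lemma outer_integral_holomorphic:
  assumes n: "n > 0"
  shows "outer_integral n holomorphic_on UNIV"
proof -
  have "(\<lambda>s. \<integral>y. indicator {0..} y *\<^sub>R (cerf (complex_of_real y + s) - cerf (complex_of_real y)) ^ n \<partial>lborel) holomorphic_on UNIV"
  proof (rule holomorphic_integral_dominated)
    show "(\<lambda>s. indicator {0..} y *\<^sub>R (cerf (complex_of_real y + s) - cerf (complex_of_real y)) ^ n) holomorphic_on UNIV" for y :: real
      by (intro holomorphic_intros)
    fix R :: real assume R: "R > 0"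
    \<comment> \<open>For \<open>norm s \<le> R\<close> the exponent is at most
      \<open>- y^2 + 2 * y * R + R^2 = 2 * R^2 - (y - R)^2\<close>, a Gaussian centred at
      \<open>R\<close>; \<open>g\<close> is the \<open>n\<close>-th power of the resulting
      bound.\<close>
    define g where "g = (\<lambda>y. (2 / sqrt pi * R) ^ n * exp (2 * real n * R\<^sup>2) * exp (- (real n * (y - R)\<^sup>2)))"
    have "integrable lborel g"
      unfolding g_def using gauss_integral(1)[of "real n" R] n by (intro integrable_mult_right) auto
    moreover have "norm (indicator {0..} y *\<^sub>R (cerf (complex_of_real y + s) - cerf (complex_of_real y)) ^ n) \<le> g y"
      if s: "norm s \<le> R" for s y
    proof (cases "y \<ge> 0")
      case y: True
      have "norm (cerf (complex_of_real y + s) - cerf (complex_of_real y))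
          \<le> 2 / sqrt pi * norm s * exp (- y\<^sup>2 + 2 * \<bar>y\<bar> * norm s + (norm s)\<^sup>2)"
        by (rule norm_cerf_shift_le)
      also have "\<dots> \<le> 2 / sqrt pi * R * exp (2 * R\<^sup>2 - (y - R)\<^sup>2)"
      proof (intro mult_mono)
        have "2 * \<bar>y\<bar> * norm s \<le> 2 * y * R" using s y by (simp add: mult_left_mono)
        moreover have "(norm s)\<^sup>2 \<le> R\<^sup>2" using s by (intro power_mono) auto
        ultimately show "exp (- y\<^sup>2 + 2 * \<bar>y\<bar> * norm s + (norm s)\<^sup>2) \<le> exp (2 * R\<^sup>2 - (y - R)\<^sup>2)"
          by (simp add: power2_diff)
      qed (use s R in auto)
      finally have "norm (cerf (complex_of_real y + s) - cerf (complex_of_real y)) ^ n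
          \<le> (2 / sqrt pi * R * exp (2 * R\<^sup>2 - (y - R)\<^sup>2)) ^ n"
        by (intro power_mono) auto
      also have "\<dots> = (2 / sqrt pi * R) ^ n * exp (real n * (2 * R\<^sup>2 - (y - R)\<^sup>2))"
        by (simp only: power_mult_distrib exp_of_nat_mult)
      also have "real n * (2 * R\<^sup>2 - (y - R)\<^sup>2) = 2 * real n * R\<^sup>2 + - (real n * (y - R)\<^sup>2)"
        by (simp add: algebra_simps)
      also have "(2 / sqrt pi * R) ^ n * exp (2 * real n * R\<^sup>2 + - (real n * (y - R)\<^sup>2)) = g y"
        by (simp only: g_def exp_add mult.assoc)
      finally show ?thesis using y by (simp add: norm_power)
    next
      case False
      then show ?thesis using R by (simp add: g_def)
    qed
    ultimately show "\<exists>g. integrable lborel g \<and> (\<forall>s y. norm s \<le> R \<longrightarrow> y \<in> space lborel \<longrightarrow>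
        norm (indicator {0..} y *\<^sub>R (cerf (complex_of_real y + s) - cerf (complex_of_real y)) ^ n) \<le> g y)"
      by blast
  qed measurable
  then show ?thesis by (simp add: outer_integral_def[abs_def] set_lebesgue_integral_def)
qed

lemma inner_integral_holomorphic: "inner_integral n holomorphic_on UNIV"
proof -
  have "(\<lambda>s. \<integral>u. indicator {0..1} u *\<^sub>R (cerf (1/2 * s * complex_of_real (u + 1)) - cerf (1/2 * s * complex_of_real (u - 1))) ^ n \<partial>lborel) holomorphic_on UNIV"
  proof (rule holomorphic_integral_dominated)
    show "(\<lambda>s. indicator {0..1} u *\<^sub>R (cerf (1/2 * s * complex_of_real (u + 1)) - cerf (1/2 * s * complex_of_real (u - 1))) ^ n) holomorphic_on UNIV" for u :: real
      by (intro holomorphic_intros)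
    fix R :: real assume R: "R > 0"
    \<comment> \<open>For \<open>norm s \<le> R\<close> and \<open>u\<close> in the unit interval
      both arguments have modulus at most \<open>R\<close>, so a bound on this compact disc
      suffices.\<close>
    have "compact (cerf ` cball 0 R)"
      by (intro compact_continuous_image continuous_intros) auto
    then obtain B where B: "\<And>z. norm z \<le> R \<Longrightarrow> norm (cerf z) \<le> B"
      using compact_imp_bounded bounded_iff by (metis imageI mem_cball_0)
    define g where "g = (\<lambda>u::real. indicator {0..1} u *\<^sub>R (2 * B) ^ n)"
    have "integrable lborel g"
      unfolding g_def by (intro borel_integrable_atLeastAtMost'[unfolded set_integrable_def] continuous_intros)
    moreover have "norm (indicator {0..1} u *\<^sub>R (cerf (1/2 * s * complex_of_real (u + 1)) - cerf (1/2 * s * complex_of_real (u - 1))) ^ n) \<le> g u"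
      if s: "norm s \<le> R" for s u
    proof (cases "u \<in> {0..1}")
      case u: True
      have "norm (1/2 * s * complex_of_real v) \<le> R" if "\<bar>v\<bar> \<le> 2" for v
        using mult_mono[OF s that] R by (simp add: norm_mult)
      then have "norm (cerf (1/2 * s * complex_of_real (u + 1))) \<le> B" "norm (cerf (1/2 * s * complex_of_real (u - 1))) \<le> B"
        using u by (auto intro!: B simp del: of_real_add of_real_diff)
      then have "norm (cerf (1/2 * s * complex_of_real (u + 1)) - cerf (1/2 * s * complex_of_real (u - 1))) \<le> 2 * B"
        using norm_triangle_ineq4 by (smt (verit))
      from power_mono[OF this norm_ge_zero, of n] show ?thesis using u by (simp add: g_def norm_power)
    qed (simp add: g_def)
    ultimately show "\<exists>g. integrable lborel g \<and> (\<forall>s u. norm s \<le> R \<longrightarrow> u \<in> space lborel \<longrightarrow>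
        norm (indicator {0..1} u *\<^sub>R (cerf (1/2 * s * complex_of_real (u + 1)) - cerf (1/2 * s * complex_of_real (u - 1))) ^ n) \<le> g u)"
      by blast
  qed measurable
  then show ?thesis by (simp add: inner_integral_def[abs_def] set_lebesgue_integral_def)
qed

lemma laplace_holomorphic:
  assumes n: "n > 0"
  shows "(\<lambda>s. \<integral>X. exp (- (s\<^sup>2 * complex_of_real (sumsq_dev n X))) \<partial>cube n) holomorphic_on UNIV"
proof -
  interpret C: prob_space "cube n" by (rule prob_space_cube)
  \<comment> \<open>The statistic is bounded by \<open>Qmax n\<close> only almost surely. Truncation
    changes it on a null set and gives a majorant at every point, as
    \<open>holomorphic_integral_dominated\<close> demands.\<close>
  define q where "q = (\<lambda>X. min (sumsq_dev n X) (Qmax n))"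
  have qm[measurable]: "q \<in> borel_measurable (cube n)" unfolding q_def by measurable
  have "AE X in cube n. q X = sumsq_dev n X"
    using AE_cube_Icc[of n] by eventually_elim (use sumsq_dev_le_Qmax[OF n] in \<open>auto simp: q_def\<close>)
  then have "(\<integral>X. exp (- (s\<^sup>2 * complex_of_real (sumsq_dev n X))) \<partial>cube n) = (\<integral>X. exp (- (s\<^sup>2 * complex_of_real (q X))) \<partial>cube n)" for s
    by (intro integral_cong_AE) auto
  moreover have "(\<lambda>s. \<integral>X. exp (- (s\<^sup>2 * complex_of_real (q X))) \<partial>cube n) holomorphic_on UNIV"
  proof (rule holomorphic_integral_dominated)
    show "(\<lambda>s. exp (- (s\<^sup>2 * complex_of_real (q X)))) holomorphic_on UNIV" for X
      by (intro holomorphic_intros)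
    fix R :: real assume R: "R > 0"
    have "norm (exp (- (s\<^sup>2 * complex_of_real (q X)))) \<le> exp (R\<^sup>2 * \<bar>Qmax n\<bar>)" if "norm s \<le> R" for s X
    proof -
      have "norm (s\<^sup>2 * complex_of_real (q X)) \<le> R\<^sup>2 * \<bar>Qmax n\<bar>"
        unfolding norm_mult norm_power
        by (intro mult_mono power_mono that) (use sumsq_dev_nonneg[of n X] in \<open>auto simp: q_def\<close>)
      then show ?thesis
        using norm_exp[of "- (s\<^sup>2 * complex_of_real (q X))"] by (simp add: order_trans del: norm_exp_eq_Re)
    qed
    then show "\<exists>g. integrable (cube n) g \<and> (\<forall>s X. norm s \<le> R \<longrightarrow> X \<in> space (cube n) \<longrightarrow>
        norm (exp (- (s\<^sup>2 * complex_of_real (q X)))) \<le> g X)"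
      by (intro exI[of _ "\<lambda>_. exp (R\<^sup>2 * \<bar>Qmax n\<bar>)"]) auto
  qed measurable
  ultimately show ?thesis by simp
qed

lemma laplace_identity:
  assumes n: "n > 0"
  shows "s ^ n * (\<integral>X. exp (- (s\<^sup>2 * complex_of_real (sumsq_dev n X))) \<partial>cube n)
    = complex_of_real (sqrt (real n) / sqrt pi * (sqrt pi / 2) ^ n) * (2 * outer_integral n s + s * inner_integral n s)"
proof -
  define D where "D = (\<lambda>s. s ^ n * (\<integral>X. exp (- (s\<^sup>2 * complex_of_real (sumsq_dev n X))) \<partial>cube n)
    - complex_of_real (sqrt (real n) / sqrt pi * (sqrt pi / 2) ^ n) * (2 * outer_integral n s + s * inner_integral n s))"
  have "D s = 0"
  \<comment> \<open>Identity theorem: the entire function \<open>D\<close> vanishes on the positive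
    reals, which accumulate at 1.\<close>
  proof (rule analytic_continuation[of D UNIV "complex_of_real ` {0<..}" 1])
    show "D holomorphic_on UNIV"
      unfolding D_def
      by (intro holomorphic_intros laplace_holomorphic[OF n] outer_integral_holomorphic[OF n] inner_integral_holomorphic)
    show "1 islimpt complex_of_real ` {0<..}"
      unfolding islimpt_approachable
    proof (intro allI impI)
      fix e :: real assume "e > 0"
      then show "\<exists>x'\<in>complex_of_real ` {0<..}. x' \<noteq> 1 \<and> dist x' 1 < e"
        by (intro bexI[of _ "complex_of_real (1 + e / 2)"]) (auto simp: dist_norm norm_divide simp del: of_real_add intro!: imageI, simp add: norm_divide)
    qed
    show "D z = 0" if "z \<in> complex_of_real ` {0<..}" for z
      using that laplace_identity_pos[OF n] by (auto simp: D_def)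
  qed auto
  then show ?thesis by (simp add: D_def)
qed

section \<open>Interchanging sum and integral\<close>

text \<open>Places the square root on the ray on which \<open>norm_cerf_ray_le\<close> holds; the
  positive real part selects the principal branch.\<close>

lemma csqrt_neg_ii:
  assumes "t > 0"
  shows "csqrt (- \<i> * complex_of_real t) = complex_of_real (sqrt t) * ((1 - \<i>) / complex_of_real (sqrt 2))"
proof (rule csqrt_unique)
  have "((1 - \<i>) / complex_of_real (sqrt 2))\<^sup>2 = - \<i>"
    by (simp add: power_divide power2_diff flip: of_real_power)
  then show "(complex_of_real (sqrt t) * ((1 - \<i>) / complex_of_real (sqrt 2)))\<^sup>2 = - \<i> * complex_of_real t"
    using assms by (simp only: power_mult_distrib flip: of_real_power) (simp add: mult.commute)
  show "0 < Re (complex_of_real (sqrt t) * ((1 - \<i>) / complex_of_real (sqrt 2))) \<or>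
    Re (complex_of_real (sqrt t) * ((1 - \<i>) / complex_of_real (sqrt 2))) = 0 \<and>
    0 \<le> Im (complex_of_real (sqrt t) * ((1 - \<i>) / complex_of_real (sqrt 2)))"
    using assms by (simp add: Re_divide_of_real)
qed

text \<open>The base of \<open>powr\<close> is the reciprocal of \<open>z = - \<i> * t\<close>, and
  \<open>z\<close> lies off the branch cut, so the logarithms are opposite. Both factors are then
  exponentials of opposite multiples of \<open>Ln z\<close>, for odd \<open>m\<close> as
  well.\<close>

lemma ii_div_powr_mult_csqrt_power:
  assumes "t > 0"
  shows "(\<i> / complex_of_real t) powr (complex_of_real (real m / 2)) * csqrt (- \<i> * complex_of_real t) ^ m = 1"
proof -
  have t: "complex_of_real t \<noteq> 0" using assms by simp
  define z where "z = - \<i> * complex_of_real t"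
  have z: "z \<noteq> 0" "z \<notin> \<real>\<^sub>\<le>\<^sub>0" using assms by (auto simp: z_def complex_nonpos_Reals_iff)
  have "inverse z = \<i> / complex_of_real t" using t by (simp add: z_def field_simps)
  then have L: "Ln (\<i> / complex_of_real t) = - Ln z" using Ln_inverse[OF z(2)] by simp
  have "(\<i> / complex_of_real t) powr (complex_of_real (real m / 2)) = exp (- (of_nat m * (Ln z / 2)))"
    using t by (simp add: powr_def L)
  moreover have "csqrt z ^ m = exp (of_nat m * (Ln z / 2))"
    unfolding csqrt_exp_Ln[OF z(1)] by (rule exp_of_nat_mult[symmetric])
  ultimately show ?thesis by (simp add: z_def flip: exp_add)
qed

lemma norm_ii_div_powr:
  assumes "t > 0"
  shows "norm ((\<i> / complex_of_real t) powr (complex_of_real a)) = t powr (- a)"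
proof -
  have "\<i> / complex_of_real t \<noteq> 0" using assms by simp
  then have "norm ((\<i> / complex_of_real t) powr (complex_of_real a)) = exp (a * ln (norm (\<i> / complex_of_real t)))"
    by (simp add: powr_def)
  also have "norm (\<i> / complex_of_real t) = inverse t" using assms by (simp add: norm_divide inverse_eq_divide)
  finally show ?thesis using assms by (simp add: powr_def ln_inverse)
qed

text \<open>The majorant is a product of a summable sequence and an integrable function, so the
  integrals of the absolute values form a summable series.\<close>

lemma set_lebesgue_integral_suminf_dominated:
  fixes f :: "nat \<Rightarrow> real \<Rightarrow> real"
  assumes A: "A \<in> sets lborel" and f: "\<And>j. f j \<in> borel_measurable borel"
    and g: "set_integrable lborel A g" and B: "summable B"
    and le: "\<And>j y. y \<in> A \<Longrightarrow> \<bar>f j y\<bar> \<le> B j * g y"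
  shows "(LBINT y:A. \<Sum>j. f j y) = (\<Sum>j. LBINT y:A. f j y)"
    and "summable (\<lambda>j. \<bar>LBINT y:A. f j y\<bar>)"
proof -
  define G where "G = (\<lambda>y. indicator A y *\<^sub>R g y)"
  define F where "F = (\<lambda>j y. indicator A y *\<^sub>R f j y)"
  have G: "integrable lborel G" using g by (simp add: G_def set_integrable_def)
  have le': "norm (F j y) \<le> B j * G y" for j y
    using le[of y j] by (auto simp: F_def G_def indicator_def)
  have Fm: "F j \<in> borel_measurable lborel" for j
    unfolding F_def using A f by simp
  have Fi: "integrable lborel (F j)" for j
    by (rule Bochner_Integration.integrable_bound[OF integrable_mult_right[OF G] Fm])
       (use le' in \<open>auto intro: order_trans[OF _ abs_ge_self]\<close>)
  have sG: "summable (\<lambda>j. B j * integral\<^sup>L lborel G)" using B by (rule summable_mult2)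
  have nF: "(\<integral>y. norm (F j y) \<partial>lborel) \<le> B j * integral\<^sup>L lborel G" for j
  proof -
    have "(\<integral>y. norm (F j y) \<partial>lborel) \<le> (\<integral>y. B j * G y \<partial>lborel)"
      by (intro integral_mono integrable_norm Fi integrable_mult_right G le')
    then show ?thesis by simp
  qed
  have sF: "summable (\<lambda>j. \<integral>y. norm (F j y) \<partial>lborel)"
    by (rule summable_comparison_test'[OF sG]) (use nF in \<open>simp add: Bochner_Integration.integral_nonneg\<close>)
  have "(\<integral>y. (\<Sum>j. F j y) \<partial>lborel) = (\<Sum>j. integral\<^sup>L lborel (F j))"
  proof (rule integral_suminf[OF Fi _ sF])
    show "AE y in lborel. summable (\<lambda>j. norm (F j y))"
      by (intro AE_I2 summable_comparison_test'[OF summable_mult2[OF B]]) (use le' in auto)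
  qed
  moreover have "indicator A y *\<^sub>R (\<Sum>j. f j y) = (\<Sum>j. F j y)" for y
    by (simp add: F_def indicator_def)
  ultimately show "(LBINT y:A. \<Sum>j. f j y) = (\<Sum>j. LBINT y:A. f j y)"
    by (simp add: set_lebesgue_integral_def F_def)
  show "summable (\<lambda>j. \<bar>LBINT y:A. f j y\<bar>)"
    by (rule summable_comparison_test'[OF sF])
       (use integral_norm_bound[of lborel "F _"] in \<open>simp add: set_lebesgue_integral_def F_def\<close>)
qed

text \<open>As \<open>tk n k\<close> is proportional to \<open>k\<close>, the terms are a constant
  times \<open>k powr (- a - 1)\<close>.\<close>

lemma summable_tk_powr:
  assumes "n \<ge> 2" "a > 0"
  shows "summable (\<lambda>j. C * tk n (Suc j) powr (- a) / real (Suc j))"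
proof -
  have Q: "Qmax n > 0" using Qmax_pos[OF assms(1)] .
  have "summable (\<lambda>j. real (Suc j) powr (- a - 1))"
    using assms summable_real_powr_iff[of "- a - 1"] by (subst summable_Suc_iff) simp
  then have "summable (\<lambda>j. (C * (pi / Qmax n) powr (- a)) * real (Suc j) powr (- a - 1))"
    by (rule summable_mult)
  also have "(\<lambda>j. (C * (pi / Qmax n) powr (- a)) * real (Suc j) powr (- a - 1)) = (\<lambda>j. C * tk n (Suc j) powr (- a) / real (Suc j))"
  proof
    fix j
    have "tk n (Suc j) = (pi / Qmax n) * real (Suc j)" by (simp add: tk_def)
    then have "tk n (Suc j) powr (- a) = (pi / Qmax n) powr (- a) * real (Suc j) powr (- a)"
      using Q by (simp only:) (rule powr_mult; simp)
    moreover have "real (Suc j) powr (- a - 1) = real (Suc j) powr (- a) / real (Suc j)"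
      by (simp add: powr_diff del: of_nat_Suc)
    ultimately show "(C * (pi / Qmax n) powr (- a)) * real (Suc j) powr (- a - 1) = C * tk n (Suc j) powr (- a) / real (Suc j)"
      by simp
  qed
  finally show ?thesis .
qed

lemma norm_outer_integrand_le:
  assumes "t \<ge> 0" "y \<ge> 0" "n > 0"
  shows "norm ((cerf (complex_of_real y + complex_of_real (sqrt t) * ((1 - \<i>) / complex_of_real (sqrt 2))) - cerf (complex_of_real y)) ^ n)
    \<le> (4 / sqrt pi) ^ n * exp (- y\<^sup>2)"
proof -
  have "norm ((cerf (complex_of_real y + complex_of_real (sqrt t) * ((1 - \<i>) / complex_of_real (sqrt 2))) - cerf (complex_of_real y)) ^ n)
     \<le> (4 / sqrt pi * exp (- y\<^sup>2)) ^ n"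
    unfolding norm_power using assms by (intro power_mono norm_cerf_ray_le) auto
  also have "\<dots> = (4 / sqrt pi) ^ n * exp (- y\<^sup>2) ^ n" by (rule power_mult_distrib)
  \<comment> \<open>A number in the unit interval dominates its positive powers; one Gaussian factor
    is enough for integrability.\<close>
  also have "\<dots> \<le> (4 / sqrt pi) ^ n * exp (- y\<^sup>2)"
    using power_decreasing[of 1 n "exp (- y\<^sup>2)"] assms by (intro mult_left_mono) auto
  finally show ?thesis .
qed

text \<open>Since \<open>u - 1 \<le> 0\<close>, oddness of \<open>cerf\<close> moves the second
  argument onto the ray; both values then obey the ray bound with \<open>y = 0\<close>.\<close>

lemma norm_inner_integrand_le:
  fixes u t :: real
  assumes "t \<ge> 0" "0 \<le> u" "u \<le> 1"
  defines "s \<equiv> complex_of_real (sqrt t) * ((1 - \<i>) / complex_of_real (sqrt 2))"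
  shows "norm ((cerf (1/2 * s * complex_of_real (u + 1)) - cerf (1/2 * s * complex_of_real (u - 1))) ^ n) \<le> (8 / sqrt pi) ^ n"
proof -
  have b: "norm (cerf (1/2 * s * complex_of_real v)) \<le> 4 / sqrt pi" if "v \<ge> 0" for v
  proof -
    have "1/2 * s * complex_of_real v = complex_of_real 0 + complex_of_real (sqrt t * v / 2) * ((1 - \<i>) / complex_of_real (sqrt 2))"
      by (simp add: s_def)
    moreover have "cerf 0 = 0" by (simp add: cerf_def)
    ultimately show ?thesis
      using norm_cerf_ray_le[of 0 "sqrt t * v / 2"] assms(1) that
      by (simp only: diff_zero real_sqrt_ge_zero mult_nonneg_nonneg divide_nonneg_nonneg) simp
  qed
  have "1/2 * s * complex_of_real (u - 1) = - (1/2 * s * complex_of_real (1 - u))"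
    by (simp add: field_simps)
  then have "cerf (1/2 * s * complex_of_real (u - 1)) = - cerf (1/2 * s * complex_of_real (1 - u))"
    by (simp only: cerf_minus)
  then have "norm (cerf (1/2 * s * complex_of_real (u + 1)) - cerf (1/2 * s * complex_of_real (u - 1))) \<le> 4 / sqrt pi + 4 / sqrt pi"
    using b[of "u + 1"] b[of "1 - u"] assms
      norm_triangle_ineq[of "cerf (1/2 * s * complex_of_real (u + 1))" "cerf (1/2 * s * complex_of_real (1 - u))"]
    by (simp del: of_real_add of_real_diff)
  from power_mono[OF this norm_ge_zero, of n] show ?thesis by (simp add: norm_power)
qed

text \<open>At this \<open>s\<close> one has \<open>s^2 = - \<i> * t\<close>, so the Laplace
  transform becomes the characteristic function at \<open>t\<close>. Multiplying the Laplace
  identity by the power of \<open>\<i> / t\<close> inverse to \<open>s ^ n\<close> isolates it, and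
  the sine is its imaginary part.\<close>

lemma expectation_sin_sumsq_dev:
  assumes n: "n > 0" and t: "t > 0"
  defines "s \<equiv> csqrt (- \<i> * complex_of_real t)"
  shows "(\<integral>X. sin (t * sumsq_dev n X) \<partial>cube n) = 2 * (sqrt (real n) / sqrt pi * (sqrt pi / 2) ^ n) *
    (Im ((\<i> / complex_of_real t) powr (complex_of_real (real n / 2)) * outer_integral n s)
     + 1 / 2 * Im ((\<i> / complex_of_real t) powr (complex_of_real ((real n - 1) / 2)) * inner_integral n s))"
proof -
  interpret C: prob_space "cube n" by (rule prob_space_cube)
  define c where "c = (\<i> / complex_of_real t) powr (complex_of_real (real n / 2))"
  define d where "d = (\<i> / complex_of_real t) powr (complex_of_real ((real n - 1) / 2))"
  define K where "K = sqrt (real n) / sqrt pi * (sqrt pi / 2) ^ n"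
  define E where "E = (\<integral>X. exp (- (s\<^sup>2 * complex_of_real (sumsq_dev n X))) \<partial>cube n)"
  have c: "c * s ^ n = 1"
    unfolding c_def s_def by (rule ii_div_powr_mult_csqrt_power[OF t])
  have d: "d * s ^ (n - 1) = 1"
    using ii_div_powr_mult_csqrt_power[OF t, of "n - 1"] n unfolding d_def s_def by (simp add: of_nat_diff)
  have sn: "s ^ n = s * s ^ (n - 1)" using n by (cases n) auto
  \<comment> \<open>The extra factor \<open>s\<close> at the inner integral lowers the exponent from
    \<open>n / 2\<close> to \<open>(n - 1) / 2\<close>.\<close>
  have "d = (c * s ^ n) * d" by (simp add: c)
  also have "\<dots> = c * s * (d * s ^ (n - 1))" by (simp add: sn)
  finally have cs: "c * s = d" unfolding d by simp
  have "E = (c * s ^ n) * E" by (simp add: c)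
  also have "\<dots> = c * (complex_of_real K * (2 * outer_integral n s + s * inner_integral n s))"
    unfolding K_def laplace_identity[OF n, symmetric] E_def by simp
  also have "\<dots> = complex_of_real K * (2 * (c * outer_integral n s) + d * inner_integral n s)"
    unfolding cs[symmetric] by (simp add: algebra_simps)
  finally have E: "E = complex_of_real K * (2 * (c * outer_integral n s) + d * inner_integral n s)" .
  have s2: "s\<^sup>2 = - \<i> * complex_of_real t" by (simp add: s_def)
  have ex: "exp (- (s\<^sup>2 * complex_of_real q)) = cis (t * q)" for q
    by (simp add: s2 cis_conv_exp mult.assoc)
  have "(\<integral>X. sin (t * sumsq_dev n X) \<partial>cube n) = (\<integral>X. Im (cis (t * sumsq_dev n X)) \<partial>cube n)" by simp
  also have "\<dots> = Im (\<integral>X. cis (t * sumsq_dev n X) \<partial>cube n)"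
  proof (rule integral_Im)
    have "cis \<in> borel_measurable borel" by (intro borel_measurable_continuous_onI continuous_intros)
    from measurable_compose[OF _ this, of "\<lambda>X. t * sumsq_dev n X"]
    have "(\<lambda>X. cis (t * sumsq_dev n X)) \<in> borel_measurable (cube n)" by simp
    then show "integrable (cube n) (\<lambda>X. cis (t * sumsq_dev n X))"
      by (intro C.integrable_const_bound[of _ 1]) auto
  qed
  also have "\<dots> = Im E" unfolding E_def ex ..
  also have "\<dots> = K * (2 * Im (c * outer_integral n s) + Im (d * inner_integral n s))"
    by (simp only: E Im_complex_of_real Re_complex_of_real times_complex.sel plus_complex.sel) simp
  finally show ?thesis by (simp add: K_def c_def d_def algebra_simps)
qed

lemma coefficient_eq:
  assumes "n \<ge> 3"
  shows "2 / pi * (2 * (sqrt (real n) / sqrt pi * (sqrt pi / 2) ^ n)) = 1 / 2 * sqrt (real n) * (sqrt pi / 2) ^ (n - 3)"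
proof -
  \<comment> \<open>Splitting off a cube: its value \<open>pi * sqrt pi / 8\<close> meets
    \<open>4 / (pi * sqrt pi)\<close> to give \<open>1 / 2\<close>. The exponent
    \<open>n - 3\<close> is a genuine difference because \<open>n \<ge> 3\<close>.\<close>
  have "(sqrt pi / 2) ^ n = (sqrt pi / 2) ^ (n - 3) * (sqrt pi / 2) ^ 3"
    using assms by (simp flip: power_add)
  also have "(sqrt pi / 2) ^ 3 = pi * sqrt pi / 8"
    by (simp add: power3_eq_cube)
  finally have "(sqrt pi / 2) ^ n = (sqrt pi / 2) ^ (n - 3) * (pi * sqrt pi / 8)" .
  then show ?thesis by (simp only:) (simp add: field_simps)
qed

section \<open>Assembly of the distribution function\<close>

theorem theorem3:
  fixes n :: nat and x :: real
  assumes "n \<ge> 3" and "0 \<le> x" and "x < Qmax n"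
  shows "measure (\<Pi>\<^sub>M i\<in>{..<n}. uniform_measure lborel {0..1::real})
            {X \<in> space (\<Pi>\<^sub>M i\<in>{..<n}. uniform_measure lborel {0..1::real}). sumsq_dev n X \<le> x}
    = 1/2 * sqrt (real n) * (sqrt pi / 2) ^ (n - 3) *
      ( (LBINT y:{0..}. (\<Sum>j. let k = Suc j; t = tk n k in
            Im (((\<i> / complex_of_real t) powr (real n / 2)) *
                (cerf (complex_of_real y + csqrt (- \<i> * complex_of_real t)) - cerf (complex_of_real y)) ^ n)
            * (1 - cos (t * x)) / real k))
      + 1/2 * (LBINT u:{0..1}. (\<Sum>j. let k = Suc j; t = tk n k in
            Im (((\<i> / complex_of_real t) powr ((real n - 1) / 2)) *
                (cerf (1/2 * csqrt (- \<i> * complex_of_real t) * complex_of_real (u + 1))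
                 - cerf (1/2 * csqrt (- \<i> * complex_of_real t) * complex_of_real (u - 1))) ^ n)
            * (1 - cos (t * x)) / real k)) )"
proof -
  interpret C: prob_space "cube n" by (rule prob_space_cube)
  have n0: "n > 0" and n2: "n \<ge> 2" using assms(1) by auto
  have Q: "Qmax n > 0" using Qmax_pos[OF n2] .
  \<comment> \<open>Indices start at 0 here, so \<open>t j\<close> stands for
    \<open>t\<^sub>k\<close> with \<open>k = j + 1\<close>. The letters \<open>o\<close> and
    \<open>i\<close> in the names below mark the outer and inner integral.\<close>
  define t where "t = (\<lambda>j. tk n (Suc j))"
  define s where "s = (\<lambda>j. csqrt (- \<i> * complex_of_real (t j)))"
  define co where "co = (\<lambda>j. (\<i> / complex_of_real (t j)) powr (complex_of_real (real n / 2)))"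
  define ci where "ci = (\<lambda>j. (\<i> / complex_of_real (t j)) powr (complex_of_real ((real n - 1) / 2)))"
  define ho where "ho = (\<lambda>j y. (cerf (complex_of_real y + s j) - cerf (complex_of_real y)) ^ n)"
  define hi where "hi = (\<lambda>j u. (cerf (1/2 * s j * complex_of_real (u + 1)) - cerf (1/2 * s j * complex_of_real (u - 1))) ^ n)"
  define fo where "fo = (\<lambda>j y. Im (co j * ho j y) * (1 - cos (t j * x)) / real (Suc j))"
  define fi where "fi = (\<lambda>j u. Im (ci j * hi j u) * (1 - cos (t j * x)) / real (Suc j))"
  have t: "t j > 0" for j using Q by (simp add: t_def tk_def)
  have s: "s j = complex_of_real (sqrt (t j)) * ((1 - \<i>) / complex_of_real (sqrt 2))" for j
    unfolding s_def by (rule csqrt_neg_ii[OF t])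
  have hom[measurable]: "ho j \<in> borel_measurable borel" for j
    unfolding ho_def by measurable
  have him[measurable]: "hi j \<in> borel_measurable borel" for j
    unfolding hi_def by measurable
  have w: "0 \<le> 1 - cos (t j * x)" "1 - cos (t j * x) \<le> 2" for j
    using cos_le_one[of "t j * x"] cos_ge_minus_one[of "t j * x"] by linarith+
  \<comment> \<open>The bound separates a coefficient depending on \<open>j\<close> from a function
    \<open>G\<close> of the integration variable, as the interchange lemma requires; the 2 bounds
    \<open>1 - cos\<close>.\<close>
  have Im_le: "\<bar>Im (c * h) * (1 - cos (t j * x)) / real (Suc j)\<bar> \<le> (2 * B) * norm c / real (Suc j) * G"
    if "norm h \<le> B * G" for c h B G j
  proof -
    have "\<bar>Im (c * h)\<bar> \<le> norm c * (B * G)"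
      using abs_Im_le_cmod[of "c * h"] mult_left_mono[OF that norm_ge_zero[of c]] by (simp add: norm_mult)
    then have "\<bar>Im (c * h)\<bar> * (1 - cos (t j * x)) \<le> (norm c * (B * G)) * 2"
      using w by (intro mult_mono) (auto intro: order_trans[OF abs_ge_zero])
    then have "\<bar>Im (c * h)\<bar> * (1 - cos (t j * x)) / real (Suc j) \<le> (norm c * (B * G)) * 2 / real (Suc j)"
      by (rule divide_right_mono) simp
    then show ?thesis using w(1)[of j] by (simp add: abs_mult mult_ac del: of_nat_Suc)
  qed
  have ho_le: "norm (ho j y) \<le> (4 / sqrt pi) ^ n * exp (- y\<^sup>2)" if "y \<in> {0..}" for j y
    unfolding ho_def s using norm_outer_integrand_le[of "t j" y n] t[of j] that n0 by simp
  have hi_le: "norm (hi j u) \<le> (8 / sqrt pi) ^ n * 1" if "u \<in> {0..1}" for j u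
    unfolding hi_def s using norm_inner_integrand_le[of "t j" u n] t[of j] that by simp
  have go: "set_integrable lborel {0..} (\<lambda>y::real. exp (- y\<^sup>2))"
    using integrable_mult_indicator[OF _ gauss_integral(1)[of 1 0], of "{0..}"] by (simp add: set_integrable_def)
  have gi: "set_integrable lborel {0..1} (\<lambda>u::real. 1 :: real)"
    by (intro borel_integrable_atLeastAtMost' continuous_intros)
  have fo_le: "\<bar>fo j y\<bar> \<le> (2 * (4 / sqrt pi) ^ n) * norm (co j) / real (Suc j) * exp (- y\<^sup>2)" if "y \<in> {0..}" for j y
    unfolding fo_def by (rule Im_le[OF ho_le[OF that]])
  have fi_le: "\<bar>fi j u\<bar> \<le> (2 * (8 / sqrt pi) ^ n) * norm (ci j) / real (Suc j) * 1" if "u \<in> {0..1}" for j u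
    unfolding fi_def by (rule Im_le[OF hi_le[OF that]])
  \<comment> \<open>The modulus of \<open>co j\<close> is \<open>t j powr (- (n / 2))\<close>, so
    together with \<open>1 / (j + 1)\<close> the coefficients decay faster than
    \<open>1 / j\<close>; likewise for \<open>ci\<close> with exponent
    \<open>(n - 1) / 2\<close>.\<close>
  have so: "summable (\<lambda>j. (2 * (4 / sqrt pi) ^ n) * norm (co j) / real (Suc j))"
    unfolding co_def norm_ii_div_powr[OF t] unfolding t_def using n0 by (intro summable_tk_powr[OF n2]) simp
  have si: "summable (\<lambda>j. (2 * (8 / sqrt pi) ^ n) * norm (ci j) / real (Suc j))"
    unfolding ci_def norm_ii_div_powr[OF t] unfolding t_def using n2 by (intro summable_tk_powr[OF n2]) simp
  have fom: "fo j \<in> borel_measurable borel" and fim: "fi j \<in> borel_measurable borel" for j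
    unfolding fo_def fi_def by measurable
  note O = set_lebesgue_integral_suminf_dominated[OF _ fom go so fo_le, simplified]
  note I = set_lebesgue_integral_suminf_dominated[OF _ fim gi si fi_le, simplified]
  have hoi: "set_integrable lborel {0..} (ho j)" for j
    unfolding set_integrable_def
    by (rule Bochner_Integration.integrable_bound[OF integrable_mult_right[OF go[unfolded set_integrable_def], of "(4 / sqrt pi) ^ n"]])
       (use ho_le in \<open>auto simp: indicator_def\<close>)
  have hii: "set_integrable lborel {0..1} (hi j)" for j
    unfolding set_integrable_def
    by (rule Bochner_Integration.integrable_bound[OF integrable_mult_right[OF gi[unfolded set_integrable_def], of "(8 / sqrt pi) ^ n"]])
       (use hi_le in \<open>auto simp: indicator_def\<close>)
  have Im_int: "(LBINT y:A. Im (c * h y) * p / q) = Im (c * (LBINT y:A. h y)) * p / q"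
    if "set_integrable lborel A h" for A c and h :: "real \<Rightarrow> complex" and p q :: real
  proof -
    have "complex_integrable lborel (\<lambda>y. c * (indicator A y *\<^sub>R h y))"
      using that unfolding set_integrable_def by (rule integrable_mult_right)
    from integral_Im[OF this] have "(\<integral>y. Im (c * (indicator A y *\<^sub>R h y)) \<partial>lborel) = Im (c * (LBINT y:A. h y))"
      unfolding set_lebesgue_integral_def integral_mult_right_zero .
    also have "(\<lambda>y. Im (c * (indicator A y *\<^sub>R h y))) = (\<lambda>y. indicator A y *\<^sub>R Im (c * h y))"
      by (auto simp: indicator_def)
    finally have "(LBINT y:A. Im (c * h y)) = Im (c * (LBINT y:A. h y))"
      unfolding set_lebesgue_integral_def .
    then show ?thesis by simp
  qed
  define K where "K = sqrt (real n) / sqrt pi * (sqrt pi / 2) ^ n"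
  \<comment> \<open>This scaling turns the bound \<open>Qmax n\<close> into \<open>pi\<close> and
    makes \<open>k * A\<close> equal to \<open>t\<^sub>k\<close> times the statistic, so the values
    at \<open>t\<^sub>k\<close> are exactly the sine coefficients.\<close>
  define A where "A = (\<lambda>X. pi / Qmax n * sumsq_dev n X)"
  define b where "b = pi / Qmax n * x"
  define c where "c = (\<lambda>k. C.expectation (\<lambda>X. sin (real (Suc k) * A X)) * (1 - cos (real (Suc k) * b)) / real (Suc k))"
  have c_eq: "c j = 2 * K * ((LBINT y:{0..}. fo j y) + 1 / 2 * (LBINT u:{0..1}. fi j u))" for j
  proof -
    have tA: "real (Suc j) * A X = t j * sumsq_dev n X" for X
      by (simp add: A_def t_def tk_def)
    have tb: "real (Suc j) * b = t j * x"
      by (simp add: b_def t_def tk_def)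
    have "(LBINT y:{0..}. fo j y) = Im (co j * outer_integral n (s j)) * (1 - cos (t j * x)) / real (Suc j)"
      by (simp only: fo_def Im_int[OF hoi]) (simp only: outer_integral_def ho_def)
    moreover have "(LBINT u:{0..1}. fi j u) = Im (ci j * inner_integral n (s j)) * (1 - cos (t j * x)) / real (Suc j)"
      by (simp only: fi_def Im_int[OF hii]) (simp only: inner_integral_def hi_def)
    moreover have "c j = (2 * K * (Im (co j * outer_integral n (s j)) + 1 / 2 * Im (ci j * inner_integral n (s j)))) * (1 - cos (t j * x)) / real (Suc j)"
      unfolding c_def tA tb expectation_sin_sumsq_dev[OF n0 t] K_def co_def ci_def s_def ..
    moreover have "(2 * K * (u + 1 / 2 * v)) * p / q = 2 * K * (u * p / q + 1 / 2 * (v * p / q))" for u v p q :: real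
      by (cases "q = 0") (simp_all add: field_simps)
    ultimately show ?thesis by (simp only:)
  qed
  have sums: "summable (\<lambda>j. LBINT y:{0..}. fo j y)" "summable (\<lambda>j. LBINT u:{0..1}. fi j u)"
    using O(2) I(2) by (auto intro: summable_rabs_cancel)
  \<comment> \<open>Absolute convergence of the sine series, inherited from the two interchanges, is
    what the Abel limit consumes.\<close>
  have "summable (\<lambda>j. 2 * K * (\<bar>LBINT y:{0..}. fo j y\<bar> + 1 / 2 * \<bar>LBINT u:{0..1}. fi j u\<bar>))"
    using O(2) I(2) by (intro summable_mult summable_add)
  then have c_sum: "summable (\<lambda>j. \<bar>c j\<bar>)"
  proof (rule summable_comparison_test')
    fix j
    have "K \<ge> 0" by (simp add: K_def)
    then have "\<bar>c j\<bar> = 2 * K * \<bar>(LBINT y:{0..}. fo j y) + 1 / 2 * (LBINT u:{0..1}. fi j u)\<bar>"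
      unfolding c_eq by (simp add: abs_mult)
    also have "\<dots> \<le> 2 * K * (\<bar>LBINT y:{0..}. fo j y\<bar> + 1 / 2 * \<bar>LBINT u:{0..1}. fi j u\<bar>)"
      using \<open>K \<ge> 0\<close> by (intro mult_left_mono order_trans[OF abs_triangle_ineq]) (auto simp: abs_mult)
    finally show "norm \<bar>c j\<bar> \<le> 2 * K * (\<bar>LBINT y:{0..}. fo j y\<bar> + 1 / 2 * \<bar>LBINT u:{0..1}. fi j u\<bar>)"
      by simp
  qed
  have "measure (cube n) {X \<in> space (cube n). sumsq_dev n X \<le> x} = C.prob {X \<in> space (cube n). A X \<le> b}"
    using Q by (intro arg_cong[where f = C.prob] Collect_cong) (auto simp: A_def b_def divide_le_cancel mult_le_cancel_left)
  also have "\<dots> = 2 / pi * (\<Sum>k. c k)"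
    unfolding c_def
  proof (rule C.prob_less_sine_series)
    show "A \<in> borel_measurable (cube n)" unfolding A_def by measurable
    show "0 \<le> b" "b < pi" using assms(2,3) Q by (auto simp: b_def field_simps)
    \<comment> \<open>Almost surely the statistic is positive, at most \<open>Qmax n\<close> and
      different from \<open>x\<close>; these are the three conditions after scaling.\<close>
    show "AE X in cube n. 0 < A X \<and> A X \<le> pi \<and> A X \<noteq> b"
      using AE_cube_Icc[of n] AE_sumsq_dev_neq[OF n2, of 0] AE_sumsq_dev_neq[OF n2, of x]
    proof eventually_elim
      case (elim X)
      have "sumsq_dev n X > 0" using sumsq_dev_nonneg[of n X] elim(2) by simp
      moreover have "sumsq_dev n X \<le> Qmax n" using elim(1) by (intro sumsq_dev_le_Qmax[OF n0]) auto
      ultimately show ?case using Q elim(3) by (simp add: A_def b_def field_simps)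
    qed
    show "summable (\<lambda>k. \<bar>C.expectation (\<lambda>X. sin (real (Suc k) * A X)) * (1 - cos (real (Suc k) * b)) / real (Suc k)\<bar>)"
      using c_sum unfolding c_def .
  qed
  also have "(\<Sum>k. c k) = 2 * K * ((\<Sum>j. LBINT y:{0..}. fo j y) + 1 / 2 * (\<Sum>j. LBINT u:{0..1}. fi j u))"
    unfolding c_eq
    by (intro sums_unique[symmetric] sums_mult sums_add summable_sums sums)
  also have "\<dots> = 2 * K * ((LBINT y:{0..}. \<Sum>j. fo j y) + 1 / 2 * (LBINT u:{0..1}. \<Sum>j. fi j u))"
    using O(1) I(1) by simp
  also have "2 / pi * (2 * K * ((LBINT y:{0..}. \<Sum>j. fo j y) + 1 / 2 * (LBINT u:{0..1}. \<Sum>j. fi j u)))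
     = (2 / pi * (2 * K)) * ((LBINT y:{0..}. \<Sum>j. fo j y) + 1 / 2 * (LBINT u:{0..1}. \<Sum>j. fi j u))"
    by simp
  also have "2 / pi * (2 * K) = 1 / 2 * sqrt (real n) * (sqrt pi / 2) ^ (n - 3)"
    unfolding K_def by (rule coefficient_eq[OF assms(1)])
  finally show ?thesis
    unfolding fo_def fi_def co_def ci_def ho_def hi_def s_def t_def Let_def .
qed

end
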